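(* Let $N\ge 1$ and let $\mu$ be a continuous, translation invariant and $N$-homogeneous valuation on $\mathcal{C}^N$. Then there exists a unique function $c\colon[0,+\infty)\to\mathbb{R}$ with the following properties: $c$ is continuous, there exists $\delta>0$ such that $c(t)=0$ for all $t\in[0,\delta]$, and $$\mu(f)=\int_{(0,+\infty)}c(t)\,dS_N(f;t)\qquad\text{for all } f\in\mathcal{C}^N .$$
   Context: A convex body is a nonempty compact convex subset of $\mathbb{R}^N$. $\mathcal{C}^N$ is the set of all functions $f\colon\mathbb{R}^N\to[0,\infty)$ (called quasi-concave) such that for every $t>0$ the super-level set $L_t(f)=\{x\in\mathbb{R}^N: f(x)\ge t\}$ is either empty or a convex body. Write $f\vee g$ and $f\wedge g$ for the pointwise maximum and minimum; $f\wedge g\in\mathcal{C}^N$ whenever $f,g\in\mathcal{C}^N$. A valuation on $\mathcal{C}^N$ is a functional $\mu\colon\mathcal{C}^N\to\mathbb{R}$ with $\mu(\underline{0})=0$, where $\underline{0}$ is the identically zero function, and $\mu(f\vee g)+\mu(f\wedge g)=\mu(f)+\mu(g)$ for all $f,g\in\mathcal{C}^N$ such that $f\vee g\in\mathcal{C}^N$. It is continuous if $\mu(f_i)\to\mu(f)$ whenever $f\in\mathcal{C}^N$ and $(f_i)_{i\in\mathbb{N}}$ is a sequence in $\mathcal{C}^N$ which converges pointwise to $f$ on $\mathbb{R}^N$ and is either pointwise increasing or pointwise decreasing in $i$ (in the weak sense). It is translation invariant if $\mu(f\circ T)=\mu(f)$ for every $f\in\mathcal{C}^N$ and every translation $T$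 of $\mathbb{R}^N$. It is $k$-homogeneous if $\mu(f_\lambda)=\lambda^k\mu(f)$ for all $f\in\mathcal{C}^N$ and $\lambda>0$, where $f_\lambda(x)=f(x/\lambda)$. For $f\in\mathcal{C}^N$ let $u_N(t)=V_N(L_t(f))$, $t>0$, where $V_N$ is the Lebesgue measure on $\mathbb{R}^N$ (with $V_N(\varnothing)=0$). The function $u_N$ is decreasing and vanishes for $t>\max f$. $S_N(f;\cdot)$ denotes the non-negative Radon measure on $(0,\infty)$ which is the distributional derivative of $-u_N$, i.e. $\int_0^{\infty}\varphi'(t)u_N(t)\,dt=\int_{(0,\infty)}\varphi(t)\,dS_N(f;t)$ for all $\varphi\in C_c^\infty(0,+\infty)$. *)

theory Defs
  imports "HOL-Analysis.Analysis"
begin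

definition convex_body :: "(real ^ 'n) set \<Rightarrow> bool" where
  "convex_body K \<longleftrightarrow> K \<noteq> {} \<and> compact K \<and> convex K"

definition super_level :: "(real ^ 'n \<Rightarrow> real) \<Rightarrow> real \<Rightarrow> (real ^ 'n) set" where
  "super_level f t = {x. t \<le> f x}"

definition quasi_concave :: "(real ^ 'n \<Rightarrow> real) set" where
  "quasi_concave = {f. (\<forall>x. 0 \<le> f x) \<and>
     (\<forall>t>0. super_level f t = {} \<or> convex_body (super_level f t))}"

text \<open>Functionals on \<open>quasi_concave\<close> are total HOL functions; only their values on
  \<open>quasi_concave\<close> are ever constrained or used.\<close>

definition valuation :: "((real ^ 'n \<Rightarrow> real) \<Rightarrow> real) \<Rightarrow> bool" where
  "valuation \<mu> \<longleftrightarrow> \<mu> (\<lambda>x. 0) = 0 \<and>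
     (\<forall>f\<in>quasi_concave. \<forall>g\<in>quasi_concave.
        (\<lambda>x. max (f x) (g x)) \<in> quasi_concave \<longrightarrow>
        \<mu> (\<lambda>x. max (f x) (g x)) + \<mu> (\<lambda>x. min (f x) (g x)) = \<mu> f + \<mu> g)"

definition continuous_valuation :: "((real ^ 'n \<Rightarrow> real) \<Rightarrow> real) \<Rightarrow> bool" where
  "continuous_valuation \<mu> \<longleftrightarrow> valuation \<mu> \<and>
     (\<forall>f\<in>quasi_concave. \<forall>F :: nat \<Rightarrow> real ^ 'n \<Rightarrow> real.
        (\<forall>i. F i \<in> quasi_concave) \<longrightarrow> (\<forall>x. (\<lambda>i. F i x) \<longlonglongrightarrow> f x) \<longrightarrow>
        (\<forall>x. incseq (\<lambda>i. F i x)) \<or> (\<forall>x. decseq (\<lambda>i. F i x)) \<longrightarrow>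
        (\<lambda>i. \<mu> (F i)) \<longlonglongrightarrow> \<mu> f)"

definition translation_invariant :: "((real ^ 'n \<Rightarrow> real) \<Rightarrow> real) \<Rightarrow> bool" where
  "translation_invariant \<mu> \<longleftrightarrow>
     (\<forall>f\<in>quasi_concave. \<forall>v. \<mu> (f \<circ> (\<lambda>x. x + v)) = \<mu> f)"

definition homogeneous :: "nat \<Rightarrow> ((real ^ 'n \<Rightarrow> real) \<Rightarrow> real) \<Rightarrow> bool" where
  "homogeneous k \<mu> \<longleftrightarrow>
     (\<forall>f\<in>quasi_concave. \<forall>r>0. \<mu> (\<lambda>x. f (x /\<^sub>R r)) = r ^ k * \<mu> f)"

definition level_volume :: "(real ^ 'n \<Rightarrow> real) \<Rightarrow> real \<Rightarrow> real" where
  "level_volume f t = measure lebesgue (super_level f t)"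

text \<open>\<open>C\<^sub>c\<^sup>\<infinity>(0, +\<infinity>)\<close>, each test function being extended by zero to the whole line.\<close>

definition test_functions :: "(real \<Rightarrow> real) set" where
  "test_functions = {\<phi>. (\<forall>k x. ((deriv ^^ k) \<phi>) differentiable (at x)) \<and>
     compact (closure {t. \<phi> t \<noteq> 0}) \<and> closure {t. \<phi> t \<noteq> 0} \<subseteq> {0<..}}"

text \<open>On \<open>(0, +\<infinity>)\<close> every Borel measure that is finite on compact sets is regular, so
  local finiteness is all that has to be required of a Radon measure.\<close>

definition radon_pos :: "real measure \<Rightarrow> bool" where
  "radon_pos S \<longleftrightarrow> sets S = sets (restrict_space borel {0<..}) \<and>
     (\<forall>K. compact K \<and> K \<subseteq> {0<..} \<longrightarrow> emeasure S K < \<infinity>)"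

definition S_N :: "(real ^ 'n \<Rightarrow> real) \<Rightarrow> real measure" where
  "S_N f = (THE S. radon_pos S \<and>
     (\<forall>\<phi>\<in>test_functions.
        (LINT t:{0<..}|lborel. deriv \<phi> t * level_volume f t) = (LINT t|S. \<phi> t)))"

end

theory Submission
  imports Defs
begin

text \<open>The measure \<open>S_N f\<close> is the image under \<open>f\<close> of Lebesgue measure on \<open>{x. f x > 0}\<close>, so
  the claim reads \<open>\<mu> f = \<integral> c (f x) dx\<close>. For fixed \<open>t\<close>, the map sending \<open>K\<close> to the value of \<open>\<mu>\<close> at
  \<open>t\<close> times the indicator of \<open>K\<close> is a translation invariant valuation on convex bodies, homogeneous
  of degree \<open>N\<close>, hence a multiple \<open>c t\<close> of the volume. To see the latter without the general theory
  of valuations, dilate a body by three and cut it along a unit grid: if \<open>M\<close> bounds the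
  valuation on bodies of width at most one, then on bodies of dimension \<open>d < N\<close> one gets
  \<open>M \<le> 3 ^ d / 3 ^ N * M\<close>, so \<open>M = 0\<close>. In full dimension, after subtracting the multiple of the
  volume that agrees on the unit cube, one of the \<open>3 ^ N\<close> cells contributes nothing, since a convex
  set that meets all corner cells contains the central cell; so again \<open>M = 0\<close>.
  Monotone continuity yields the continuity of \<open>c\<close>, its vanishing near zero, and the passage
  from functions with finitely many values to all of \<open>quasi_concave\<close>.\<close>

section \<open>Valuations of maximal degree on convex bodies\<close>

abbreviation compact_convex :: "'a::euclidean_space set \<Rightarrow> bool" where
  "compact_convex K \<equiv> compact K \<and> convex K"

text \<open>The case \<open>s = t\<close> is used for sections by hyperplanes; intersections of
  slabs of width one in orthonormal directions are the cells of the grids below.\<close>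

definition slab :: "'a::euclidean_space \<Rightarrow> real \<Rightarrow> real \<Rightarrow> 'a set" where
  "slab a s t = {x. s \<le> a \<bullet> x \<and> a \<bullet> x \<le> t}"

lemma slab_Int: "slab a s t = {x. a \<bullet> x \<ge> s} \<inter> {x. a \<bullet> x \<le> t}"
  by (auto simp: slab_def)

lemma closed_slab [simp, intro]: "closed (slab a s t)"
  unfolding slab_Int by (intro closed_Int closed_halfspace_le closed_halfspace_ge)

lemma convex_slab [simp, intro]: "convex (slab a s t)"
  unfolding slab_Int by (intro convex_Int convex_halfspace_le convex_halfspace_ge)

lemma compact_convex_scaleR: "compact_convex K \<Longrightarrow> compact_convex ((*\<^sub>R) r ` K)"
  using compact_scaling convex_scaling by auto

lemma compact_convex_translation: "compact_convex K \<Longrightarrow> compact_convex ((+) v ` K)"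
  using compact_translation convex_translation by auto

locale homogeneous_body_valuation =
  fixes \<nu> :: "'a::euclidean_space set \<Rightarrow> real" and k :: nat
  assumes empty [simp]: "\<nu> {} = 0"
    and union: "\<lbrakk>compact_convex K; compact_convex L; convex (K \<union> L)\<rbrakk>
                  \<Longrightarrow> \<nu> (K \<union> L) + \<nu> (K \<inter> L) = \<nu> K + \<nu> L"
    and translation: "compact_convex K \<Longrightarrow> \<nu> ((+) v ` K) = \<nu> K"
    and scaling: "\<lbrakk>compact_convex K; r > 0\<rbrakk> \<Longrightarrow> \<nu> ((*\<^sub>R) r ` K) = r ^ k * \<nu> K"
    and decreasing: "\<lbrakk>\<And>i. compact_convex (X i); decseq X\<rbrakk> \<Longrightarrow> (\<lambda>i. \<nu> (X i)) \<longlonglongrightarrow> \<nu> (\<Inter>i. X i)"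
begin

text \<open>The dilation by 2 fixes \<open>{0}\<close> but multiplies its value by
  \<open>2 ^ k\<close>, which is not 1; translation handles the other points.\<close>

lemma singleton_eq_0:
  assumes "k > 0" shows "\<nu> {p} = 0"
proof -
  have "\<nu> {0} = 2 ^ k * \<nu> {0}" using scaling[of "{0}" 2] by simp
  moreover have "(2::real) ^ k \<noteq> 1" using one_less_power[of "2::real" k] assms by linarith
  ultimately have "\<nu> {0} = 0" by auto
  then show ?thesis using translation[of "{0}" p] by simp
qed

section \<open>Cutting bodies along a grid\<close>

text \<open>The two pieces meet in the section of \<open>K\<close> by the hyperplane at
  \<open>s\<close>. Its value is zero, so the valuation identity becomes additivity.\<close>

lemma cut:
  assumes "compact_convex K" "K \<subseteq> slab a r t" "r \<le> s" "s \<le> t" "\<nu> (K \<inter> slab a s s) = 0"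
  shows "\<nu> K = \<nu> (K \<inter> slab a r s) + \<nu> (K \<inter> slab a s t)"
proof -
  have U: "K \<inter> slab a r s \<union> K \<inter> slab a s t = K" using assms by (force simp: slab_def)
  have I: "K \<inter> slab a r s \<inter> (K \<inter> slab a s t) = K \<inter> slab a s s"
    using assms by (force simp: slab_def)
  show ?thesis
    using union[of "K \<inter> slab a r s" "K \<inter> slab a s t"] assms
    by (simp add: U I compact_Int_closed convex_Int)
qed

lemma cut_in_three:
  assumes "compact_convex K" "K \<subseteq> slab a l (l + 3)" "\<And>s. \<nu> (K \<inter> slab a s s) = 0"
  shows "\<nu> K = (\<Sum>j\<in>{0,1,2}. \<nu> (K \<inter> slab a (l + j) (l + j + 1)))"
proof -
  have 1: "\<nu> K = \<nu> (K \<inter> slab a l (l + 1)) + \<nu> (K \<inter> slab a (l + 1) (l + 3))"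
    using assms by (intro cut) auto
  have "K \<inter> slab a (l + 1) (l + 3) \<inter> slab a (l + 2) (l + 2) = K \<inter> slab a (l + 2) (l + 2)"
    by (auto simp: slab_def)
  then have "\<nu> (K \<inter> slab a (l + 1) (l + 3)) =
      \<nu> (K \<inter> slab a (l + 1) (l + 3) \<inter> slab a (l + 1) (l + 2)) +
      \<nu> (K \<inter> slab a (l + 1) (l + 3) \<inter> slab a (l + 2) (l + 3))"
    using assms by (intro cut) (auto intro: compact_Int_closed convex_Int)
  moreover have "K \<inter> slab a (l + 1) (l + 3) \<inter> slab a (l + 1) (l + 2) = K \<inter> slab a (l + 1) (l + 2)"
    "K \<inter> slab a (l + 1) (l + 3) \<inter> slab a (l + 2) (l + 3) = K \<inter> slab a (l + 2) (l + 3)"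
    by (auto simp: slab_def)
  ultimately show ?thesis using 1 by (simp add: add.commute add.left_commute)
qed

text \<open>Splitting a body along a \<open>3 \<times> \<dots> \<times> 3\<close> grid of unit cells; \<open>e\<close> measures
  by how much the bound \<open>M\<close> can be improved on one distinguished cell \<open>z\<close>.\<close>
lemma grid_bound:
  assumes "finite A" "compact_convex K" "0 \<le> e"
    and "\<And>a. a \<in> A \<Longrightarrow> K \<subseteq> slab a (l a) (l a + 3)"
    and "\<And>a s L. \<lbrakk>a \<in> A; compact_convex L; L \<subseteq> K; L \<subseteq> slab a s s\<rbrakk> \<Longrightarrow> \<nu> L = 0"
    and "\<And>L w. \<lbrakk>compact_convex L; L \<subseteq> K; \<And>a. a \<in> A \<Longrightarrow> L \<subseteq> slab a (w a) (w a + 1)\<rbrakk> \<Longrightarrow> \<bar>\<nu> L\<bar> \<le> M"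
    and "\<And>a. a \<in> A \<Longrightarrow> z a \<in> {0,1,2}"
    and "\<bar>\<nu> (K \<inter> (\<Inter>a\<in>A. slab a (l a + z a) (l a + z a + 1)))\<bar> \<le> M - e"
  shows "\<bar>\<nu> K\<bar> \<le> 3 ^ card A * M - e"
  using assms
proof (induction A arbitrary: K z e rule: finite_induct)
  case empty
  then show ?case by simp
next
  case (insert a A)
  note K = \<open>compact_convex K\<close>
  \<comment> \<open>Direction \<open>a\<close> is cut first, into three layers; the induction
    hypothesis cuts each layer in the remaining directions.\<close>
  define S where "S j = K \<inter> slab a (l a + j) (l a + j + 1)" for j
  have sum: "\<nu> K = (\<Sum>j\<in>{0,1,2}. \<nu> (S j))"
    unfolding S_def
  proof (rule cut_in_three[OF K])
    show "\<nu> (K \<inter> slab a s s) = 0" for s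
      by (rule insert.prems(4)[of a _ s]) (use K in \<open>auto intro: compact_Int_closed convex_Int\<close>)
  qed (use insert.prems(3) in auto)
  have ccS: "compact_convex (S j)" for j
    using K by (auto simp: S_def compact_Int_closed convex_Int)
  have bd: "\<bar>\<nu> (S j)\<bar> \<le> 3 ^ card A * M - e'"
    if "0 \<le> e'" "\<And>a. a \<in> A \<Longrightarrow> y a \<in> {0,1,2}"
      "\<bar>\<nu> (S j \<inter> (\<Inter>a\<in>A. slab a (l a + y a) (l a + y a + 1)))\<bar> \<le> M - e'" for j e' y
  proof (rule insert.IH)
    show "compact_convex (S j)" by fact
    show "S j \<subseteq> slab b (l b) (l b + 3)" if "b \<in> A" for b
      using insert.prems(3)[of b] that by (auto simp: S_def)
    show "\<nu> L = 0" if "b \<in> A" "compact_convex L" "L \<subseteq> S j" "L \<subseteq> slab b s s" for b s L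
      by (rule insert.prems(4)[of b L s]) (use that in \<open>auto simp: S_def\<close>)
    show "\<bar>\<nu> L\<bar> \<le> M" if "compact_convex L" "L \<subseteq> S j" "\<And>b. b \<in> A \<Longrightarrow> L \<subseteq> slab b (w b) (w b + 1)" for L w
    \<comment> \<open>A piece of layer \<open>j\<close> already has width one in direction
      \<open>a\<close>, starting at \<open>l a + j\<close>.\<close>
    proof (rule insert.prems(5)[of L "w(a := l a + j)"])
      show "L \<subseteq> slab b ((w(a := l a + j)) b) ((w(a := l a + j)) b + 1)" if "b \<in> insert a A" for b
        using that \<open>L \<subseteq> S j\<close> \<open>\<And>b. b \<in> A \<Longrightarrow> L \<subseteq> slab b (w b) (w b + 1)\<close>
        by (cases "b = a") (auto simp: S_def)
    qed (use that in \<open>auto simp: S_def\<close>)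
  qed (use that in auto)
  \<comment> \<open>No improvement is claimed for a general layer, so any cell may be the
    distinguished one; the choice here has all indices 0.\<close>
  have 0: "\<bar>\<nu> (S j)\<bar> \<le> 3 ^ card A * M" for j
  proof -
    have "compact_convex (S j \<inter> (\<Inter>a\<in>A. slab a (l a + 0) (l a + 0 + 1)))"
      using ccS by (intro conjI compact_Int_closed convex_Int) (auto intro: convex_INT)
    moreover have "S j \<inter> (\<Inter>a\<in>A. slab a (l a + 0) (l a + 0 + 1)) \<subseteq> slab b ((l(a := l a + j)) b) ((l(a := l a + j)) b + 1)"
      if "b \<in> insert a A" for b
      using that by (cases "b = a") (auto simp: S_def)
    ultimately have "\<bar>\<nu> (S j \<inter> (\<Inter>a\<in>A. slab a (l a + 0) (l a + 0 + 1)))\<bar> \<le> M"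
      by (intro insert.prems(5)[of _ "l(a := l a + j)"]) (auto simp: S_def)
    then show ?thesis using bd[of 0 "\<lambda>_. 0" j] by simp
  qed
  have eq: "S (z a) \<inter> (\<Inter>b\<in>A. slab b (l b + z b) (l b + z b + 1)) =
      K \<inter> (\<Inter>b\<in>insert a A. slab b (l b + z b) (l b + z b + 1))"
    by (auto simp: S_def)
  \<comment> \<open>The layer containing the distinguished cell inherits the improvement
    \<open>e\<close>, and exactly one of the three layers is that one.\<close>
  have 1: "\<bar>\<nu> (S (z a))\<bar> \<le> 3 ^ card A * M - e"
  proof (rule bd[of e z])
    show "\<bar>\<nu> (S (z a) \<inter> (\<Inter>b\<in>A. slab b (l b + z b) (l b + z b + 1)))\<bar> \<le> M - e"
      unfolding eq by (rule insert.prems(7))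
  qed (use insert.prems(2,6) in auto)
  have "\<bar>\<nu> K\<bar> \<le> \<bar>\<nu> (S 0)\<bar> + \<bar>\<nu> (S 1)\<bar> + \<bar>\<nu> (S 2)\<bar>" unfolding sum by simp
  also have "\<dots> \<le> 3 * (3 ^ card A * M) - e"
    using 0[of 0] 0[of 1] 0[of 2] 1 insert.prems(6)[of a] by auto
  finally show ?case using insert.hyps by simp
qed

text \<open>If \<open>\<nu>\<close> were unbounded, homogeneity would yield a decreasing sequence of bodies
  shrinking to a point on which \<open>\<bar>\<nu>\<bar> \<ge> 1\<close>.\<close>
lemma bounded_if_simple:
  assumes H: "subspace H" and k: "k > 0"
    and simple: "\<And>L. \<lbrakk>compact_convex L; L \<subseteq> H; aff_dim L < int (dim H)\<rbrakk> \<Longrightarrow> \<nu> L = 0"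
  shows "\<exists>M. \<forall>K. compact_convex K \<and> K \<subseteq> H \<and> K \<subseteq> cball 0 R \<longrightarrow> \<bar>\<nu> K\<bar> \<le> M"
proof (rule ccontr)
  assume "\<not> ?thesis"
  then have unb: "\<exists>K. compact_convex K \<and> K \<subseteq> H \<and> K \<subseteq> cball 0 R \<and> \<bar>\<nu> K\<bar> > M" for M
    by (metis not_le)
  define P where "P n L \<longleftrightarrow> compact_convex L \<and> L \<subseteq> H \<and> \<bar>\<nu> L\<bar> \<ge> 1 \<and> (\<forall>x\<in>L. \<forall>y\<in>L. dist x y \<le> (1/2)^n)"
    for n :: nat and L
  \<comment> \<open>A body in \<open>cball 0 R\<close> with value above \<open>1 / r ^ k\<close> in
    modulus still has value at least 1 after dilation by \<open>r\<close>, and it can then be moved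
    anywhere in \<open>H\<close>.\<close>
  have tiny: "\<exists>L. compact_convex L \<and> L \<subseteq> H \<and> \<bar>\<nu> L\<bar> \<ge> 1 \<and> L \<subseteq> cball p e" if "e > 0" "p \<in> H" for p e
  proof -
    define r where "r = e / (1 + \<bar>R\<bar>)"
    have r: "r > 0" "r * \<bar>R\<bar> \<le> e" using that by (auto simp: r_def field_simps)
    obtain K where K: "compact_convex K" "K \<subseteq> H" "K \<subseteq> cball 0 R" "\<bar>\<nu> K\<bar> > 1 / r ^ k"
      using unb by blast
    let ?L = "(+) p ` (*\<^sub>R) r ` K"
    have cc: "compact_convex ((*\<^sub>R) r ` K)" using K by (intro compact_convex_scaleR)
    have "\<nu> ?L = r ^ k * \<nu> K" using cc K r by (simp add: translation scaling)
    then have "\<bar>\<nu> ?L\<bar> = r ^ k * \<bar>\<nu> K\<bar>" using r by (simp add: abs_mult)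
    also have "\<dots> \<ge> 1" using K(4) r by (simp add: field_simps)
    finally have "\<bar>\<nu> ?L\<bar> \<ge> 1" .
    moreover have "?L \<subseteq> H" using K(2) H that by (auto intro!: subspace_add subspace_scale)
    moreover have "?L \<subseteq> cball p e"
    proof safe
      fix x assume "x \<in> K"
      then have "norm x \<le> \<bar>R\<bar>" using K(3) by (force simp: dist_norm)
      then have "r * norm x \<le> e" using r by (meson mult_left_mono less_imp_le order_trans)
      then show "p + r *\<^sub>R x \<in> cball p e" using r by (simp add: dist_norm)
    qed
    moreover have "compact_convex ?L" using cc by (rule compact_convex_translation)
    ultimately show ?thesis by blast
  qed
  have "\<exists>f. \<forall>n. P n (f n) \<and> f (Suc n) \<subseteq> f n"
  proof (rule dependent_nat_choice)
    obtain L where L: "compact_convex L" "L \<subseteq> H" "\<bar>\<nu> L\<bar> \<ge> 1" "L \<subseteq> cball 0 (1/2)"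
      using tiny[of "1/2" 0] subspace_0[OF H] by auto
    have "dist x y \<le> 1" if "x \<in> L" "y \<in> L" for x y
    proof -
      have "dist 0 x \<le> 1/2" "dist 0 y \<le> 1/2" using L(4) that by auto
      then show ?thesis using dist_triangle3[of x y 0] by linarith
    qed
    then show "\<exists>x. P 0 x" using L by (auto simp: P_def)
  next
    fix L n assume L: "P n L"
    then have "L \<noteq> {}" by (auto simp: P_def)
    \<comment> \<open>Bodies of smaller dimension have value zero, so \<open>L\<close> has full
      dimension in \<open>H\<close>. Hence it contains a ball of \<open>H\<close> around some point,
      with room for the next tiny body.\<close>
    have "affine hull L = H"
    proof (rule affine_dim_equal)
      show "affine hull L \<subseteq> H" using L H by (intro hull_minimal) (auto simp: P_def subspace_imp_affine)
      have "\<not> aff_dim L < int (dim H)" using simple[of L] L by (auto simp: P_def)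
      moreover have "aff_dim L \<le> aff_dim H" using L by (intro aff_dim_subset) (auto simp: P_def)
      ultimately show "aff_dim (affine hull L) = aff_dim H" using aff_dim_subspace[OF H] by simp
    qed (use H \<open>L \<noteq> {}\<close> in \<open>auto simp: subspace_imp_affine\<close>)
    moreover obtain p where "p \<in> rel_interior L"
      using rel_interior_eq_empty[of L] \<open>L \<noteq> {}\<close> L by (auto simp: P_def)
    ultimately obtain e where e: "p \<in> L" "e > 0" "cball p e \<inter> H \<subseteq> L"
      by (auto simp: mem_rel_interior_cball)
    \<comment> \<open>The bound \<open>e\<close> keeps the next body inside \<open>L\<close>; a
      radius of half of \<open>(1/2)^Suc n\<close> gives the required diameter.\<close>
    define d where "d = min e ((1/2)^Suc (Suc n))"
    have "d > 0" "p \<in> H" using e L by (auto simp: d_def P_def)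
    then obtain L' where L': "compact_convex L'" "L' \<subseteq> H" "\<bar>\<nu> L'\<bar> \<ge> 1" "L' \<subseteq> cball p d"
      using tiny by blast
    have diam: "dist x y \<le> (1/2)^Suc n" if "x \<in> L'" "y \<in> L'" for x y
    proof -
      have "dist p x \<le> (1/2)^Suc (Suc n)" "dist p y \<le> (1/2)^Suc (Suc n)"
        using L'(4) that by (auto simp: d_def)
      then show ?thesis using dist_triangle3[of x y p] by simp
    qed
    have "cball p d \<subseteq> cball p e" by (auto simp: d_def)
    then have "L' \<subseteq> L" using L' e(3) by blast
    then have "P (Suc n) L' \<and> L' \<subseteq> L" using L' diam unfolding P_def by blast
    then show "\<exists>y. P (Suc n) y \<and> y \<subseteq> L" by blast
  qed
  then obtain L where P: "\<And>n. P n (L n)" and sub: "\<And>n. L (Suc n) \<subseteq> L n" by blast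
  have dec: "decseq L" using sub by (simp add: decseq_Suc_iff)
  have "L n \<noteq> {}" for n using P[of n] by (auto simp: P_def)
  then have "\<Inter>(range L) \<noteq> {}"
    using P dec by (intro compact_nest) (auto simp: P_def decseq_def)
  then obtain p where p: "p \<in> \<Inter>(range L)" by blast
  \<comment> \<open>The diameters tend to zero. On the limit point the valuation is 0, although it
    has modulus at least 1 along the sequence.\<close>
  have "(\<Inter>i. L i) = {p}"
  proof (intro equalityI subsetI)
    fix x assume x: "x \<in> (\<Inter>i. L i)"
    have "dist x p \<le> (1/2)^n" for n using P[of n] x p by (auto simp: P_def)
    then have "dist x p \<le> 0"
      by (intro LIMSEQ_le_const[OF LIMSEQ_power_zero[of "1/2::real"]]) auto
    then show "x \<in> {p}" by simp
  qed (use p in simp)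
  then have "(\<lambda>i. \<nu> (L i)) \<longlonglongrightarrow> 0"
    using decreasing[of L] dec P singleton_eq_0[OF k] by (simp add: P_def)
  then have "(\<lambda>i. \<bar>\<nu> (L i)\<bar>) \<longlonglongrightarrow> 0" by (simp add: tendsto_rabs_zero)
  then have "(1::real) \<le> 0" by (rule LIMSEQ_le_const) (use P in \<open>auto simp: P_def\<close>)
  then show False by simp
qed

text \<open>A body of width at most one in the directions \<open>B\<close> is replaced by its threefold dilate,
  which is then cut into \<open>3 ^ card B\<close> such bodies.\<close>
lemma vanishes_if_contracting:
  assumes H: "subspace H" and k: "k > 0"
    and simple: "\<And>L. \<lbrakk>compact_convex L; L \<subseteq> H; aff_dim L < int (dim H)\<rbrakk> \<Longrightarrow> \<nu> L = 0"
    and B: "B \<subseteq> H" "pairwise orthogonal B" "\<And>b. b \<in> B \<Longrightarrow> norm b = 1" "finite B" "card B = dim H" "span B = H"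
    and e: "0 \<le> e" "3 ^ dim H < 3 ^ k + e"
    and cell: "\<And>K l M. \<lbrakk>compact_convex K; K \<subseteq> H; \<And>b. b \<in> B \<Longrightarrow> K \<subseteq> slab b (l b) (l b + 3); 0 \<le> M;
        \<And>L w. \<lbrakk>compact_convex L; L \<subseteq> H; \<And>a. a \<in> B \<Longrightarrow> L \<subseteq> slab a (w a) (w a + 1)\<rbrakk> \<Longrightarrow> \<bar>\<nu> L\<bar> \<le> M\<rbrakk>
        \<Longrightarrow> \<exists>z. (\<forall>b\<in>B. z b \<in> {0,1,2}) \<and>
              \<bar>\<nu> (K \<inter> (\<Inter>b\<in>B. slab b (l b + z b) (l b + z b + 1)))\<bar> \<le> M - e * M"
    and K: "compact_convex K" "K \<subseteq> H"
  shows "\<nu> K = 0"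
proof -
  define C where "C = {L. compact_convex L \<and> L \<subseteq> H \<and> (\<exists>w. \<forall>b\<in>B. L \<subseteq> slab b (w b) (w b + 1))}"
  obtain M0 where M0: "\<And>K. compact_convex K \<Longrightarrow> K \<subseteq> H \<Longrightarrow> K \<subseteq> cball 0 (real (card B)) \<Longrightarrow> \<bar>\<nu> K\<bar> \<le> M0"
    using bounded_if_simple[OF H k simple, of "real (card B)"] by auto
  have bounded: "\<bar>\<nu> L\<bar> \<le> max 0 M0" if L: "L \<in> C" for L
  proof (cases "L = {}")
    case False
    then obtain x where x: "x \<in> L" by blast
    obtain w where w: "\<And>b. b \<in> B \<Longrightarrow> L \<subseteq> slab b (w b) (w b + 1)" using L by (auto simp: C_def)
    \<comment> \<open>After moving a point of \<open>L\<close> to the origin, every coordinate in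
      the orthonormal basis \<open>B\<close> has modulus at most 1. Thus \<open>C\<close> consists,
      up to translation, of bodies in one fixed ball.\<close>
    have "(+) (- x) ` L \<subseteq> cball 0 (real (card B))"
    proof safe
      fix y assume y: "y \<in> L"
      let ?v = "- x + y"
      have "?v \<in> span B" using L x y B(6) by (auto simp: C_def intro!: span_diff)
      then have "?v = (\<Sum>b\<in>B. (?v \<bullet> b) *\<^sub>R b)"
        using B by (metis orthonormal_basis_expand)
      then have "norm ?v \<le> (\<Sum>b\<in>B. norm ((?v \<bullet> b) *\<^sub>R b))" by (metis norm_sum)
      also have "\<dots> \<le> (\<Sum>b\<in>B. 1)"
      proof (rule sum_mono)
        fix b assume b: "b \<in> B"
        have "x \<in> slab b (w b) (w b + 1)" "y \<in> slab b (w b) (w b + 1)" using w[OF b] x y by auto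
        then have "\<bar>?v \<bullet> b\<bar> \<le> 1" by (auto simp: slab_def inner_diff_right inner_commute[of _ b] abs_le_iff)
        then show "norm ((?v \<bullet> b) *\<^sub>R b) \<le> 1" using B(3)[OF b] by simp
      qed
      finally show "?v \<in> cball 0 (real (card B))" by simp
    qed
    moreover have "(+) (- x) ` L \<subseteq> H"
      using L x H by (auto simp: C_def intro!: subspace_diff)
    moreover have "compact_convex ((+) (- x) ` L)"
      using L unfolding C_def by (intro compact_convex_translation) blast
    ultimately have "\<bar>\<nu> ((+) (- x) ` L)\<bar> \<le> M0" by (intro M0)
    moreover have "\<nu> ((+) (- x) ` L) = \<nu> L" using L by (intro translation) (auto simp: C_def)
    ultimately show ?thesis by simp
  qed simp
  \<comment> \<open>The best bound over all bodies of width at most one. Dilation by 3 and cutting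
    will bound it by a proper fraction of itself.\<close>
  define M where "M = (SUP L\<in>C. \<bar>\<nu> L\<bar>)"
  have "{} \<in> C" by (auto simp: C_def)
  have bdd: "bdd_above ((\<lambda>L. \<bar>\<nu> L\<bar>) ` C)" using bounded by (rule bdd_aboveI2)
  have le_M: "\<bar>\<nu> L\<bar> \<le> M" if "L \<in> C" for L
    unfolding M_def using that bdd by (rule cSUP_upper)
  have M_nonneg: "0 \<le> M" using le_M[OF \<open>{} \<in> C\<close>] by simp
  have "\<bar>\<nu> L\<bar> \<le> (3 ^ dim H - e) * M / 3 ^ k" if L: "L \<in> C" for L
  proof -
    obtain w where w: "\<And>b. b \<in> B \<Longrightarrow> L \<subseteq> slab b (w b) (w b + 1)" using L by (auto simp: C_def)
    let ?K = "(*\<^sub>R) 3 ` L"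
    have cc: "compact_convex ?K" using L by (intro compact_convex_scaleR) (auto simp: C_def)
    have inH: "?K \<subseteq> H" using L H by (auto simp: C_def intro: subspace_scale)
    have K3: "?K \<subseteq> slab b (3 * w b) (3 * w b + 3)" if "b \<in> B" for b
      using w[OF that] by (auto simp: slab_def)
    have unit: "\<bar>\<nu> L\<bar> \<le> M" if "compact_convex L" "L \<subseteq> H" "\<And>a. a \<in> B \<Longrightarrow> L \<subseteq> slab a (w a) (w a + 1)" for L w
      using that by (intro le_M) (auto simp: C_def)
    have "\<exists>z. (\<forall>b\<in>B. z b \<in> {0,1,2}) \<and>
        \<bar>\<nu> (?K \<inter> (\<Inter>b\<in>B. slab b (3 * w b + z b) (3 * w b + z b + 1)))\<bar> \<le> M - e * M"
      by (rule cell[OF cc inH K3 M_nonneg unit])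
    then obtain z where z: "\<forall>b\<in>B. z b \<in> {0,1,2}"
        "\<bar>\<nu> (?K \<inter> (\<Inter>b\<in>B. slab b (3 * w b + z b) (3 * w b + z b + 1)))\<bar> \<le> M - e * M"
      by (elim exE conjE)
    have "\<bar>\<nu> ?K\<bar> \<le> 3 ^ card B * M - e * M"
    proof (rule grid_bound[OF \<open>finite B\<close> cc])
      show "0 \<le> e * M" using e M_nonneg by simp
      show "\<nu> L' = 0" if b: "b \<in> B" and L': "compact_convex L'" "L' \<subseteq> ?K" "L' \<subseteq> slab b s s" for b s L'
      proof (rule simple)
        show "L' \<subseteq> H" using L' inH by blast
        show "aff_dim L' < int (dim H)"
        proof (rule ccontr)
          \<comment> \<open>A piece of full dimension lying in the hyperplane would force all of
            \<open>H\<close> into it, in particular both 0 and the unit vector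
            \<open>b\<close>.\<close>
          assume *: "\<not> ?thesis"
          then have "L' \<noteq> {}" by auto
          have "affine hull L' = H"
          proof (rule affine_dim_equal)
            show "affine hull L' \<subseteq> H"
              using \<open>L' \<subseteq> H\<close> H by (intro hull_minimal) (auto simp: subspace_imp_affine)
            have "aff_dim L' \<le> aff_dim H" using \<open>L' \<subseteq> H\<close> by (rule aff_dim_subset)
            then show "aff_dim (affine hull L') = aff_dim H" using aff_dim_subspace[OF H] * by simp
          qed (use H \<open>L' \<noteq> {}\<close> in \<open>auto simp: subspace_imp_affine\<close>)
          moreover have "affine hull L' \<subseteq> {x. b \<bullet> x = s}"
            using L'(3) by (intro hull_minimal affine_hyperplane) (auto simp: slab_def)
          ultimately have "0 \<in> {x. b \<bullet> x = s}" "b \<in> {x. b \<bullet> x = s}"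
            using subspace_0[OF H] b B(1) by auto
          then have "b = 0" by simp
          then show False using B(3)[OF b] by simp
        qed
      qed (use L' in auto)
      show "\<bar>\<nu> L'\<bar> \<le> M" if "compact_convex L'" "L' \<subseteq> ?K" "\<And>a. a \<in> B \<Longrightarrow> L' \<subseteq> slab a (v a) (v a + 1)" for L' v
        by (rule unit[of L' v]) (use that inH in auto)
    qed (use K3 z in auto)
    then have "3 ^ k * \<bar>\<nu> L\<bar> \<le> 3 ^ dim H * M - e * M"
      using scaling[of L 3] L B(5) by (auto simp: C_def abs_mult)
    then show ?thesis by (simp add: field_simps)
  qed
  \<comment> \<open>The factor of \<open>M\<close> on the right is less than 1 by the assumption on
    \<open>e\<close>, which leaves only \<open>M = 0\<close>.\<close>
  then have "M \<le> (3 ^ dim H - e) * M / 3 ^ k"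
    unfolding M_def by (intro cSUP_least) (use \<open>{} \<in> C\<close> in auto)
  then have "(3 ^ k + e - 3 ^ dim H) * M \<le> 0" by (simp add: field_simps)
  moreover have "0 < 3 ^ k + e - 3 ^ dim H" using e(2) by (simp only: diff_gt_0_iff_gt)
  ultimately have "M \<le> 0" by (metis mult_pos_pos not_le)
  then have M0: "M = 0" using M_nonneg by (rule antisym)
  have "bounded K" using K(1) by (simp add: compact_imp_bounded)
  then obtain R where R: "\<And>x. x \<in> K \<Longrightarrow> norm x \<le> R" "R > 0"
    unfolding bounded_pos by auto
  \<comment> \<open>This factor shrinks the ball of radius \<open>R\<close> to radius 1/2, so that
    the dilate of \<open>K\<close> has width at most one in every direction of
    \<open>B\<close>.\<close>
  let ?r = "1 / (2 * R)"
  have "(*\<^sub>R) ?r ` K \<in> C"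
  proof -
    have "(*\<^sub>R) ?r ` K \<subseteq> slab b (-1/2) (-1/2 + 1)" if "b \<in> B" for b
    proof safe
      fix x assume "x \<in> K"
      then have "\<bar>b \<bullet> x\<bar> \<le> R"
        using Cauchy_Schwarz_ineq2[of b x] B(3)[OF that] R(1)[of x] by simp
      then show "?r *\<^sub>R x \<in> slab b (-1/2) (-1/2 + 1)"
        using R(2) by (auto simp: slab_def field_simps abs_le_iff)
    qed
    moreover have "(*\<^sub>R) ?r ` K \<subseteq> H" using K H by (auto intro: subspace_scale)
    ultimately show ?thesis
      using compact_convex_scaleR[OF K(1), of ?r] unfolding C_def
      by (elim conjE, intro CollectI conjI exI[of _ "\<lambda>_. -1/2"] ballI)
  qed
  then have "\<nu> ((*\<^sub>R) ?r ` K) = 0" using le_M[of "(*\<^sub>R) ?r ` K"] M0 by simp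
  then show ?thesis using scaling[of K ?r] K R by simp
qed

text \<open>Induction on the dimension: with a point of \<open>K\<close> moved to the origin,
  \<open>H\<close> is the span of the body, and the induction hypothesis kills all bodies of smaller
  dimension in \<open>H\<close>. Since \<open>dim H < k\<close>, already
  \<open>3 ^ dim H < 3 ^ k\<close>, and no gain from a distinguished cell is required, whence
  \<open>e = 0\<close>.\<close>

lemma lower_dim_eq_0:
  assumes "compact_convex K" "aff_dim K < int k"
  shows "\<nu> K = 0"
  using assms
proof (induction "nat (aff_dim K)" arbitrary: K rule: less_induct)
  case less
  show ?case
  proof (cases "K = {}")
    case False
    then obtain x where x: "x \<in> K" by blast
    let ?K = "(+) (- x) ` K"
    define H where "H = span ?K"
    have H: "subspace H" "?K \<subseteq> H" by (auto simp: H_def span_superset)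
    have dimH: "aff_dim K = int (dim H)"
      using aff_dim_eq_dim[of x K] x by (simp add: H_def hull_inc)
    obtain B where B: "B \<subseteq> H" "pairwise orthogonal B" "\<And>x. x \<in> B \<Longrightarrow> norm x = 1"
        "independent B" "card B = dim H" "span B = H"
      using orthonormal_basis_subspace[OF H(1)] by blast
    have simple: "\<nu> L = 0" if "compact_convex L" "L \<subseteq> H" "aff_dim L < int (dim H)" for L
    proof (cases "L = {}")
      case False
      then have "0 \<le> aff_dim L" using aff_dim_geq aff_dim_empty by (metis aff_dim_negative_iff linorder_not_le)
      then show ?thesis using less that dimH by (intro less.hyps) auto
    qed simp
    have "\<nu> ?K = 0"
    proof (rule vanishes_if_contracting[where e = 0 and B = B and H = H])
      show "3 ^ dim H < 3 ^ k + (0::real)" using less.prems dimH by simp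
      show "k > 0" using less.prems dimH by linarith
      show "\<exists>z. (\<forall>b\<in>B. z b \<in> {0,1,2}) \<and>
              \<bar>\<nu> (K \<inter> (\<Inter>b\<in>B. slab b (l b + z b) (l b + z b + 1)))\<bar> \<le> M - 0 * M"
        if "compact_convex K" "K \<subseteq> H" 
          "\<And>L w. \<lbrakk>compact_convex L; L \<subseteq> H; \<And>a. a \<in> B \<Longrightarrow> L \<subseteq> slab a (w a) (w a + 1)\<rbrakk> \<Longrightarrow> \<bar>\<nu> L\<bar> \<le> M"
        for K l M
      proof -
        have "\<bar>\<nu> (K \<inter> (\<Inter>b\<in>B. slab b (l b + 0) (l b + 0 + 1)))\<bar> \<le> M"
        proof (rule that(3))
          show "compact_convex (K \<inter> (\<Inter>b\<in>B. slab b (l b + 0) (l b + 0 + 1)))"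
            using that(1) by (intro conjI compact_Int_closed convex_Int) (auto intro: convex_INT)
        qed (use that(2) in auto)
        then show ?thesis by (intro exI[of _ "\<lambda>_. 0"]) auto
      qed
      show "compact_convex ?K" using less.prems(1) by (rule compact_convex_translation)
    qed (use H B simple independent_imp_finite in auto)
    then show ?thesis using translation[of K "- x"] less.prems by simp
  qed simp
qed

end

section \<open>Full dimension: comparison with the volume\<close>

lemma cbox_eq_Inter_slab:
  "cbox p (p + One) = (\<Inter>b\<in>Basis. slab b (p \<bullet> b) (p \<bullet> b + 1))"
proof -
  have "x \<in> cbox p (p + One) \<longleftrightarrow> (\<forall>b\<in>Basis. p \<bullet> b \<le> b \<bullet> x \<and> b \<bullet> x \<le> p \<bullet> b + 1)" for x
    by (simp add: mem_box inner_add_left inner_commute[of x])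
  then show ?thesis by (auto simp: slab_def)
qed

text \<open>A convex set meeting all corner cells of the grid contains its central cell: a hyperplane
  separating a central point from the set would separate it from some corner cell.\<close>
lemma central_cell_subset:
  fixes K :: "'a::euclidean_space set"
  assumes K: "compact_convex K"
    and corners: "\<And>z. \<forall>b\<in>Basis. z b \<in> {0, 2} \<Longrightarrow>
      K \<inter> (\<Inter>b\<in>Basis. slab b (l b + z b) (l b + z b + 1)) \<noteq> {}"
  shows "(\<Inter>b\<in>Basis. slab b (l b + 1) (l b + 1 + 1)) \<subseteq> K"
proof (rule ccontr)
  assume "\<not> ?thesis"
  then obtain p where p: "p \<notin> K" "\<And>b. b \<in> Basis \<Longrightarrow> p \<in> slab b (l b + 1) (l b + 1 + 1)" by auto
  obtain a s where a: "a \<bullet> p < s" "\<And>x. x \<in> K \<Longrightarrow> a \<bullet> x > s"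
    using separating_hyperplane_closed_point[of K p] K p(1) compact_imp_closed by blast
  \<comment> \<open>The signs of the coordinates of \<open>a\<close> select the corner cell on which
    \<open>a \<bullet> x\<close> is smallest; there it never exceeds
    \<open>a \<bullet> p\<close>.\<close>
  define z where "z b = (if a \<bullet> b \<ge> 0 then 0 else 2 :: real)" for b
  have "\<forall>b\<in>Basis. z b \<in> {0, 2}" by (auto simp: z_def)
  then obtain x where x: "x \<in> K" "\<And>b. b \<in> Basis \<Longrightarrow> x \<in> slab b (l b + z b) (l b + z b + 1)"
    using corners by blast
  have "a \<bullet> x = (\<Sum>b\<in>Basis. (a \<bullet> b) * (x \<bullet> b))" by (rule euclidean_inner)
  also have "\<dots> \<le> (\<Sum>b\<in>Basis. (a \<bullet> b) * (p \<bullet> b))"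
  proof (rule sum_mono)
    fix b :: 'a assume b: "b \<in> Basis"
    show "(a \<bullet> b) * (x \<bullet> b) \<le> (a \<bullet> b) * (p \<bullet> b)"
    proof (cases "a \<bullet> b \<ge> 0")
      case True
      then have "x \<bullet> b \<le> p \<bullet> b"
        using x(2)[OF b] p(2)[OF b] by (auto simp: z_def slab_def inner_commute[of b])
      then show ?thesis using True by (rule mult_left_mono)
    next
      case False
      then have "p \<bullet> b \<le> x \<bullet> b"
        using x(2)[OF b] p(2)[OF b] by (auto simp: z_def slab_def inner_commute[of b])
      then show ?thesis using False by (intro mult_left_mono_neg) auto
    qed
  qed
  also have "\<dots> = a \<bullet> p" by (rule euclidean_inner[symmetric])
  finally show False using a(1) a(2)[OF x(1)] by simp
qed

context homogeneous_body_valuation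
begin

text \<open>Now \<open>3 ^ dim H = 3 ^ k\<close>, so one cell must contribute nothing, which is the
  gain \<open>e = 1\<close>. Either some corner cell misses \<open>K\<close>, or all corner cells
  meet it; then the central cell lies in \<open>K\<close> and is a translate of the unit
  cube.\<close>

lemma eq_0_if_unit_cube_eq_0:
  assumes k: "k = DIM('a)" and cube: "\<nu> (cbox 0 One) = 0" and K: "compact_convex K"
  shows "\<nu> K = 0"
proof (rule vanishes_if_contracting[where e = 1 and B = Basis and H = UNIV])
  show "\<nu> L = 0" if "compact_convex L" "L \<subseteq> UNIV" "aff_dim L < int (dim (UNIV::'a set))" for L
    using that k by (intro lower_dim_eq_0) (auto simp: dim_UNIV)
  show "\<exists>z. (\<forall>b\<in>Basis. z b \<in> {0,1,2}) \<and>
          \<bar>\<nu> (K \<inter> (\<Inter>b\<in>Basis. slab b (l b + z b) (l b + z b + 1)))\<bar> \<le> M - 1 * M"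
    if K: "compact_convex K" for K l M
  proof (cases "\<exists>z. (\<forall>b\<in>Basis. z b \<in> {0,2}) \<and> K \<inter> (\<Inter>b\<in>Basis. slab b (l b + z b) (l b + z b + 1)) = {}")
    case True
    then obtain z where z: "\<forall>b\<in>Basis. z b \<in> {0,2}"
      "K \<inter> (\<Inter>b\<in>Basis. slab b (l b + z b) (l b + z b + 1)) = {}" by blast
    then show ?thesis by (intro exI[of _ z]) (auto simp: z(2))
  next
    case False
    define p where "p = (\<Sum>b\<in>Basis. (l b + 1) *\<^sub>R b)"
    have eq: "(\<Inter>b\<in>Basis. slab b (l b + 1) (l b + 1 + 1)) = cbox p (p + One)"
      unfolding cbox_eq_Inter_slab by (auto simp: p_def inner_sum_left_Basis)
    have "cbox p (p + One) \<subseteq> K"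
      unfolding eq[symmetric] by (rule central_cell_subset[OF K]) (use False in blast)
    moreover have "\<nu> (cbox p (p + One)) = 0"
      using translation[of "cbox 0 One" p] cube cbox_translation[of p 0 One]
      by (simp add: image_image)
    ultimately show ?thesis
      by (intro exI[of _ "\<lambda>_. 1"]) (auto simp only: eq inf.absorb2 insert_iff abs_zero)
  qed
  show "compact_convex K" by fact
qed (use k in \<open>auto simp: dim_UNIV pairwise_def orthogonal_def inner_Basis\<close>)

end

lemma homogeneous_body_valuation_measure:
  "homogeneous_body_valuation (measure (lebesgue :: 'a::euclidean_space measure)) DIM('a)"
proof
  fix K L :: "'a set" assume "compact_convex K" "compact_convex L"
  then have "K \<in> lmeasurable" "L \<in> lmeasurable" by (auto intro: lmeasurable_compact)
  then show "measure lebesgue (K \<union> L) + measure lebesgue (K \<inter> L) = measure lebesgue K + measure lebesgue L"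
    by (simp add: measure_Un3)
next
  fix K :: "'a set" and r :: real assume "r > 0"
  then show "measure lebesgue ((*\<^sub>R) r ` K) = r ^ DIM('a) * measure lebesgue K"
    using measure_lebesgue_affine[of r 0 K] by simp
next
  fix K :: "nat \<Rightarrow> 'a set" assume K: "\<And>i. compact_convex (K i)" "decseq K"
  then have "K i \<in> lmeasurable" for i by (auto intro: lmeasurable_compact)
  then have "range K \<subseteq> sets lebesgue" "emeasure lebesgue (K i) \<noteq> \<infinity>" for i
    using fmeasurableD2[of "K i" lebesgue] by (auto dest: fmeasurableD simp del: emeasure_completion)
  then show "(\<lambda>i. measure lebesgue (K i)) \<longlonglongrightarrow> measure lebesgue (\<Inter>i. K i)"
    using K by (intro Lim_measure_decseq)
qed (auto simp: measure_translation)

text \<open>The unit cube has volume 1, so subtracting \<open>c\<close> times the volume gives a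
  valuation of the same kind that vanishes on the unit cube, hence everywhere.\<close>

lemma (in homogeneous_body_valuation) eq_volume:
  assumes k: "k = DIM('a)" and K: "compact_convex K"
  shows "\<nu> K = \<nu> (cbox 0 One) * measure lebesgue K"
proof -
  interpret V: homogeneous_body_valuation "measure (lebesgue :: 'a measure)" k
    unfolding k by (rule homogeneous_body_valuation_measure)
  define c where "c = \<nu> (cbox 0 One)"
  interpret D: homogeneous_body_valuation "\<lambda>K. \<nu> K - c * measure lebesgue K" k
  proof
    show "\<nu> (K \<union> L) - c * measure lebesgue (K \<union> L) + (\<nu> (K \<inter> L) - c * measure lebesgue (K \<inter> L)) =
        \<nu> K - c * measure lebesgue K + (\<nu> L - c * measure lebesgue L)"
      if "compact_convex K" "compact_convex L" "convex (K \<union> L)" for K L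
      using arg_cong[OF V.union[OF that], of "\<lambda>x. c * x"] union[OF that] by (simp add: distrib_left)
  qed (use translation scaling V.translation V.scaling decreasing V.decreasing in
      \<open>auto simp: algebra_simps intro!: tendsto_diff tendsto_mult_left\<close>)
  have "\<nu> (cbox 0 One) - c * measure lebesgue (cbox 0 (One::'a)) = 0"
    by (simp add: measure_completion c_def)
  then have "\<nu> K - c * measure lebesgue K = 0"
    by (rule D.eq_0_if_unit_cube_eq_0[OF k _ K])
  then show ?thesis by (simp add: c_def)
qed

section \<open>The measure \<open>S_N\<close> as an image of Lebesgue measure\<close>

text \<open>For \<open>m = 0\<close> this is the classical smooth function that is flat at 0. The
  powers of \<open>1 / x\<close> make the family closed under differentiation up to linear
  combinations.\<close>

definition exp_bump :: "nat \<Rightarrow> real \<Rightarrow> real" where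
  "exp_bump m x = (if x > 0 then (1 / x) ^ m * exp (- (1 / x)) else 0)"

lemma exp_bump_tendsto_0: "(exp_bump m \<longlongrightarrow> 0) (at 0)"
proof -
  have "((\<lambda>x. inverse x ^ m / exp (inverse x)) \<longlongrightarrow> 0) (at_right (0::real))"
    by (rule filterlim_compose[OF tendsto_power_div_exp_0 filterlim_inverse_at_top_right])
  then have "(exp_bump m \<longlongrightarrow> 0) (at_right 0)"
    by (rule Lim_transform_eventually)
       (auto simp: exp_bump_def eventually_at_filter field_simps exp_minus)
  moreover have "(exp_bump m \<longlongrightarrow> 0) (at_left 0)"
    by (rule Lim_transform_eventually[OF tendsto_const]) (auto simp: exp_bump_def eventually_at_filter)
  ultimately show ?thesis by (simp add: filterlim_split_at)
qed

text \<open>Away from 0 this is calculus. At 0 the difference quotient of \<open>exp_bump m\<close>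
  is \<open>exp_bump (Suc m)\<close>, which tends to 0.\<close>

lemma has_real_derivative_exp_bump:
  "(exp_bump m has_real_derivative exp_bump (m + 2) x - real m * exp_bump (m + 1) x) (at x)"
proof -
  consider "x > 0" | "x < 0" | "x = 0" by linarith
  then show ?thesis
  proof cases
    case 1
    have "((\<lambda>x. (1 / x) ^ m * exp (- (1 / x))) has_real_derivative
        exp_bump (m + 2) x - real m * exp_bump (m + 1) x) (at x)"
    proof -
      have "((\<lambda>x. (1 / x) ^ m * exp (- (1 / x))) has_real_derivative
          (real m * (1 / x) ^ (m - 1) * (- 1 / x\<^sup>2)) * exp (- (1 / x)) + (1 / x) ^ m * (exp (- (1 / x)) * (1 / x\<^sup>2))) (at x)"
        using 1 by (auto intro!: derivative_eq_intros simp: power2_eq_square)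
      also have "(real m * (1 / x) ^ (m - 1) * (- 1 / x\<^sup>2)) * exp (- (1 / x)) + (1 / x) ^ m * (exp (- (1 / x)) * (1 / x\<^sup>2)) =
          exp_bump (m + 2) x - real m * exp_bump (m + 1) x"
        using 1 by (cases m) (simp_all add: exp_bump_def field_simps power2_eq_square)
      finally show ?thesis .
    qed
    moreover have "eventually (\<lambda>y. y > 0) (nhds x)"
      using 1 eventually_nhds_in_open[of "{0<..}" x] by simp
    then have "eventually (\<lambda>y. exp_bump m y = (1 / y) ^ m * exp (- (1 / y))) (nhds x)"
      by eventually_elim (simp add: exp_bump_def)
    ultimately show ?thesis by (subst DERIV_cong_ev[OF refl _ refl])
  next
    case 2
    have "eventually (\<lambda>y. y < 0) (nhds x)"
      using 2 eventually_nhds_in_open[of "{..<0}" x] by simp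
    then have "eventually (\<lambda>y. exp_bump m y = 0) (nhds x)"
      by eventually_elim (simp add: exp_bump_def)
    then show ?thesis using 2 by (subst DERIV_cong_ev[OF refl _ refl]) (auto simp: exp_bump_def)
  next
    case 3
    have "((\<lambda>h. exp_bump m h / h) \<longlongrightarrow> 0) (at 0)"
      by (rule Lim_transform_eventually[OF exp_bump_tendsto_0[of "Suc m"]])
         (auto simp: exp_bump_def)
    then show ?thesis using 3 by (simp add: DERIV_def exp_bump_def)
  qed
qed

text \<open>An algebra of functions that is closed under differentiation; hence all its members
  are smooth.\<close>
inductive exp_bump_algebra :: "(real \<Rightarrow> real) \<Rightarrow> bool" where
  bump: "exp_bump_algebra (\<lambda>x. exp_bump m (a * x + b))"
| const: "exp_bump_algebra (\<lambda>x. c)"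
| add: "exp_bump_algebra f \<Longrightarrow> exp_bump_algebra g \<Longrightarrow> exp_bump_algebra (\<lambda>x. f x + g x)"
| mult: "exp_bump_algebra f \<Longrightarrow> exp_bump_algebra g \<Longrightarrow> exp_bump_algebra (\<lambda>x. f x * g x)"

lemma exp_bump_algebra_deriv:
  assumes "exp_bump_algebra f"
  shows "\<exists>f'. exp_bump_algebra f' \<and> (\<forall>x. (f has_real_derivative f' x) (at x))"
  using assms
proof induction
  case (bump m a b)
  \<comment> \<open>The difference is written as a sum with the constant \<open>- real m\<close>,
    matching the generators of the algebra.\<close>
  let ?f' = "\<lambda>x. a * (exp_bump (m + 2) (a * x + b) + (- real m) * exp_bump (m + 1) (a * x + b))"
  have "exp_bump_algebra ?f'"
    by (intro exp_bump_algebra.intros)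
  moreover have "((\<lambda>x. exp_bump m (a * x + b)) has_real_derivative ?f' x) (at x)" for x
  proof -
    have "((\<lambda>x. a * x + b) has_real_derivative a) (at x)"
      by (auto intro!: derivative_eq_intros)
    from DERIV_chain2[OF has_real_derivative_exp_bump this] show ?thesis
      by (simp add: algebra_simps)
  qed
  ultimately show ?case by (intro exI[of _ ?f']) blast
next
  case (const c)
  show ?case by (intro exI[of _ "\<lambda>x. 0"]) (auto intro: exp_bump_algebra.const)
next
  case (add f g)
  then obtain f' g' where "exp_bump_algebra f'" "exp_bump_algebra g'"
    "\<forall>x. (f has_real_derivative f' x) (at x)" "\<forall>x. (g has_real_derivative g' x) (at x)" by blast
  then show ?case
    by (intro exI[of _ "\<lambda>x. f' x + g' x"]) (auto intro: exp_bump_algebra.add DERIV_add)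
next
  case (mult f g)
  then obtain f' g' where *: "exp_bump_algebra f'" "exp_bump_algebra g'"
    "\<forall>x. (f has_real_derivative f' x) (at x)" "\<forall>x. (g has_real_derivative g' x) (at x)" by blast
  then have "exp_bump_algebra (\<lambda>x. f' x * g x + g' x * f x)"
    using mult by (intro exp_bump_algebra.intros)
  then show ?case
    using * by (intro exI[of _ "\<lambda>x. f' x * g x + g' x * f x"]) (auto intro: DERIV_mult)
qed

lemma exp_bump_algebra_smooth:
  assumes "exp_bump_algebra f"
  shows "((deriv ^^ k) f) differentiable (at x)"
proof -
  have "exp_bump_algebra ((deriv ^^ k) f)"
  proof (induction k)
    case (Suc k)
    then obtain f' where f': "exp_bump_algebra f'" "\<And>x. ((deriv ^^ k) f has_real_derivative f' x) (at x)"
      using exp_bump_algebra_deriv by blast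
    then have "deriv ((deriv ^^ k) f) = f'" by (intro ext DERIV_imp_deriv)
    then show ?case using f' by simp
  qed (use assms in simp)
  then show ?thesis using exp_bump_algebra_deriv real_differentiable_def by blast
qed

text \<open>The growing slope \<open>Suc n\<close> makes these functions converge pointwise to the
  indicator of the open interval; being positive for every \<open>n\<close>, it keeps the set where
  they are nonzero fixed.\<close>

definition interval_bump :: "real \<Rightarrow> real \<Rightarrow> nat \<Rightarrow> real \<Rightarrow> real" where
  "interval_bump a b n x = exp_bump 0 (real (Suc n) * (x - a)) * exp_bump 0 (real (Suc n) * (b - x))"

lemma interval_bump_eq_0_iff: "interval_bump a b n x = 0 \<longleftrightarrow> x \<notin> {a<..<b}"
  by (auto simp: interval_bump_def exp_bump_def zero_less_mult_iff simp del: of_nat_Suc)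

lemma interval_bump_bounds: "0 \<le> interval_bump a b n x" "interval_bump a b n x \<le> 1"
proof -
  have "0 \<le> exp_bump 0 y \<and> exp_bump 0 y \<le> 1" for y by (simp add: exp_bump_def)
  then show "0 \<le> interval_bump a b n x" "interval_bump a b n x \<le> 1"
    unfolding interval_bump_def by (simp_all add: mult_le_one)
qed

lemma interval_bump_test_function:
  assumes "0 < a"
  shows "interval_bump a b n \<in> test_functions"
proof -
  have "exp_bump_algebra (\<lambda>x. exp_bump 0 (real (Suc n) * x + (- real (Suc n) * a)) *
      exp_bump 0 ((- real (Suc n)) * x + real (Suc n) * b))"
    by (intro exp_bump_algebra.intros)
  also have "(\<lambda>x. exp_bump 0 (real (Suc n) * x + (- real (Suc n) * a)) *
      exp_bump 0 ((- real (Suc n)) * x + real (Suc n) * b)) = interval_bump a b n"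
    by (rule ext) (simp add: interval_bump_def algebra_simps del: of_nat_Suc)
  finally have "\<forall>k x. ((deriv ^^ k) (interval_bump a b n)) differentiable (at x)"
    using exp_bump_algebra_smooth by blast
  moreover have "compact (closure {a<..<b})" by (simp add: compact_closure)
  moreover have "{t. interval_bump a b n t \<noteq> 0} = {a<..<b}" by (auto simp: interval_bump_eq_0_iff)
  moreover have "closure {a<..<b} \<subseteq> {a..b}" by (rule closure_minimal) auto
  then have "closure {a<..<b} \<subseteq> {0<..}" using assms by force
  ultimately show ?thesis unfolding test_functions_def by simp
qed

lemma interval_bump_tendsto_indicator:
  "(\<lambda>n. interval_bump a b n x) \<longlonglongrightarrow> indicator {a<..<b} x"
proof (cases "x \<in> {a<..<b}")
  case True
  have lim: "(\<lambda>n. 1 / (real (Suc n) * c)) \<longlonglongrightarrow> 0" for c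
    using tendsto_mult[OF LIMSEQ_inverse_real_of_nat tendsto_const[of "inverse c"]]
    by (simp add: field_simps del: of_nat_Suc)
  have "(\<lambda>n. exp (- (1 / (real (Suc n) * (x - a)))) * exp (- (1 / (real (Suc n) * (b - x)))))
      \<longlonglongrightarrow> exp (- 0) * exp (- 0)"
    by (intro tendsto_intros lim)
  then show ?thesis
    using True by (simp add: interval_bump_def exp_bump_def zero_less_mult_iff del: of_nat_Suc)
next
  case False
  then show ?thesis using interval_bump_eq_0_iff[of a b _ x] by simp
qed

lemma borel_measurable_interval_bump [measurable]: "interval_bump a b n \<in> borel_measurable borel"
  unfolding interval_bump_def exp_bump_def by measurable

section \<open>Radon measures are determined by test functions\<close>

lemma radon_pos_interval_finite:
  assumes "radon_pos S" "0 < a"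
  shows "{a<..<b} \<in> sets S" "emeasure S {a<..<b} < \<infinity>"
proof -
  have sets: "sets S = sets (restrict_space borel {0<..})" using assms by (simp add: radon_pos_def)
  show 1: "{a<..<b} \<in> sets S"
    unfolding sets using assms by (subst sets_restrict_space_iff) auto
  have "{a..b} \<in> sets S"
    unfolding sets using assms by (subst sets_restrict_space_iff) auto
  then have "emeasure S {a<..<b} \<le> emeasure S {a..b}" by (intro emeasure_mono) auto
  also have "\<dots> < \<infinity>" using assms unfolding radon_pos_def by (elim conjE allE[of _ "{a..b}"]) auto
  finally show "emeasure S {a<..<b} < \<infinity>" .
qed

lemma radon_pos_interval_bump_tendsto:
  assumes "radon_pos S" "0 < a"
  shows "(\<lambda>n. LINT t|S. interval_bump a b n t) \<longlonglongrightarrow> measure S {a<..<b}"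
proof -
  have fin: "{a<..<b} \<in> sets S" "emeasure S {a<..<b} < \<infinity>" using assms radon_pos_interval_finite by auto
  have sets: "sets S = sets (restrict_space borel {0<..})" using assms by (simp add: radon_pos_def)
  have "(\<lambda>n. LINT t|S. interval_bump a b n t) \<longlonglongrightarrow> (LINT t|S. indicator {a<..<b} t)"
  proof (rule integral_dominated_convergence)
    show "integrable S (indicator {a<..<b} :: real \<Rightarrow> real)" using fin by simp
    show "interval_bump a b n \<in> borel_measurable S" for n
      unfolding measurable_cong_sets[OF sets refl] by (rule measurable_restrict_space1) measurable
    show "AE x in S. norm (interval_bump a b n x) \<le> indicator {a<..<b} x" for n
    proof (rule AE_I2)
      fix x
      show "norm (interval_bump a b n x) \<le> indicator {a<..<b} x"
        using interval_bump_bounds[of a b n x] interval_bump_eq_0_iff[of a b n x]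
        by (auto simp: indicator_def)
    qed
  qed (use fin interval_bump_tendsto_indicator in auto)
  then show ?thesis using fin by simp
qed

text \<open>Bump functions show that the two measures agree on open intervals with positive left
  end, and exhaustion extends this to left end 0. These intervals generate the Borel sets of the
  half-line and are stable under intersection.\<close>

lemma radon_pos_eqI:
  assumes S: "radon_pos S" and T: "radon_pos T"
    and eq: "\<And>\<phi>. \<phi> \<in> test_functions \<Longrightarrow> (LINT t|S. \<phi> t) = (LINT t|T. \<phi> t)"
  shows "S = T"
proof -
  have sets: "sets S = sets (restrict_space borel {0<..})" "sets T = sets (restrict_space borel {0<..})"
    using S T by (auto simp: radon_pos_def)
  have pos: "emeasure S {a<..<b} = emeasure T {a<..<b}" if "0 < a" for a b
  proof -
    have "measure S {a<..<b} = measure T {a<..<b}"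
      using radon_pos_interval_bump_tendsto[OF T that, of b] eq interval_bump_test_function[OF that]
      by (intro LIMSEQ_unique[OF radon_pos_interval_bump_tendsto[OF S that, of b]]) simp
    then show ?thesis
      using radon_pos_interval_finite[OF S that, of b] radon_pos_interval_finite[OF T that, of b]
      by (simp add: emeasure_eq_ennreal_measure)
  qed
  \<comment> \<open>The trace of all open intervals on the half-line, a form that yields the
    generated sigma-algebra directly. Intervals starting at 0 occur and may have infinite
    measure.\<close>
  define E where "E = (\<inter>) {0<..} ` range (\<lambda>(a, b). {a<..<b::real})"
  have E_eq: "E = {{a<..<b} |a b. 0 \<le> a}"
  proof (intro equalityI subsetI)
    fix X assume "X \<in> E"
    then obtain a b where "X = {0<..} \<inter> {a<..<b}" by (auto simp: E_def)
    then have "X = {max 0 a<..<b}" by auto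
    then show "X \<in> {{a<..<b} |a b. 0 \<le> a}" by (intro CollectI exI[of _ "max 0 a"] exI[of _ b]) auto
  next
    fix X :: "real set" assume "X \<in> {{a<..<b} |a b. 0 \<le> a}"
    then obtain a b where "X = {a<..<b}" "0 \<le> a" by blast
    then have "X = {0<..} \<inter> (case (a, b) of (a, b) \<Rightarrow> {a<..<b})" by auto
    then show "X \<in> E" unfolding E_def by blast
  qed
  have borel: "sets borel = sigma_sets UNIV (range (\<lambda>(a, b). {a<..<b::real}))"
    unfolding borel_eq_box by (simp add: box_real case_prod_unfold)
  have "{0<..} \<in> sigma_sets UNIV (range (\<lambda>(a, b). {a<..<b::real}))"
    unfolding borel[symmetric] by simp
  then have gen: "sets (restrict_space borel {0<..}) = sigma_sets {0<..} E"
    unfolding E_def sets_restrict_space borel by (intro sigma_sets_Int) auto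
  have E_sets: "X \<in> sets S" "X \<in> sets T" if "X \<in> E" for X
    using that unfolding sets gen by auto
  have eqE: "emeasure S X = emeasure T X" if X: "X \<in> E" for X
  proof -
    obtain a b where ab: "X = {a<..<b}" "0 \<le> a" using X unfolding E_eq by blast
    define A where "A n = {a + 1 / Suc n<..<b}" for n
    have "incseq A"
    proof (rule incseq_SucI)
      fix n
      have "1 / real (Suc (Suc n)) \<le> 1 / real (Suc n)" by (intro frac_le) auto
      then show "A n \<subseteq> A (Suc n)" unfolding A_def by (auto simp del: of_nat_Suc)
    qed
    have "(\<Union>n. A n) = X"
    proof (intro equalityI subsetI)
      fix x assume x: "x \<in> X"
      then obtain n where "1 / Suc n < x - a"
        using nat_approx_posE[of "x - a"] ab by auto
      then show "x \<in> (\<Union>n. A n)" using x ab by (auto simp: A_def intro!: exI[of _ n])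
    next
      fix x assume "x \<in> (\<Union>n. A n)"
      then obtain n where "a + 1 / Suc n < x" "x < b" by (auto simp: A_def)
      moreover have "0 < 1 / real (Suc n)" by simp
      ultimately have "a < x" by linarith
      then show "x \<in> X" unfolding ab using \<open>x < b\<close> by simp
    qed
    have An: "emeasure S (A n) = emeasure T (A n)" "A n \<in> sets S" "A n \<in> sets T" for n
    proof -
      have "0 < a + 1 / Suc n" using ab by (simp add: add_nonneg_pos)
      then show "emeasure S (A n) = emeasure T (A n)" "A n \<in> sets S" "A n \<in> sets T"
        unfolding A_def using pos S T radon_pos_interval_finite by auto
    qed
    have "(\<lambda>n. emeasure S (A n)) \<longlonglongrightarrow> emeasure S X" "(\<lambda>n. emeasure T (A n)) \<longlonglongrightarrow> emeasure T X"
      unfolding \<open>(\<Union>n. A n) = X\<close>[symmetric] using An(2,3) \<open>incseq A\<close>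
      by (intro Lim_emeasure_incseq; auto)+
    then show ?thesis unfolding An by (rule LIMSEQ_unique)
  qed
  have spaces: "space S = {0<..}" "space T = {0<..}"
    using sets_eq_imp_space_eq[OF sets(1)] sets_eq_imp_space_eq[OF sets(2)] by (auto simp: space_restrict_space)
  show ?thesis
  \<comment> \<open>The covering intervals stay away from 0 and from infinity, so they have finite
    measure.\<close>
  proof (rule measure_eqI_generator_eq[where E = E and \<Omega> = "{0<..}" and A = "\<lambda>n. {1 / Suc n<..<real n}"])
    show "Int_stable E"
    proof (rule Int_stableI)
      fix X Y assume "X \<in> E" "Y \<in> E"
      then obtain a b c d where "X = {a<..<b}" "Y = {c<..<d}" "0 \<le> a" "0 \<le> c" by (auto simp: E_eq)
      then show "X \<inter> Y \<in> E"
        unfolding E_eq by (intro CollectI exI[of _ "max a c"] exI[of _ "min b d"]) auto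
    qed
    show "E \<subseteq> Pow {0<..}" by (auto simp: E_def)
    show "range (\<lambda>n. {1 / real (Suc n)<..<real n}) \<subseteq> E"
      unfolding E_eq by auto
    show "(\<Union>n. {1 / real (Suc n)<..<real n}) = {0<..}"
    proof (intro equalityI subsetI)
      fix x :: real assume x: "x \<in> {0<..}"
      then obtain n where n: "1 / Suc n < x" using nat_approx_posE[of x] by auto
      obtain m where m: "x < real m" using reals_Archimedean2 by blast
      have "1 / real (Suc (max m n)) \<le> 1 / real (Suc n)" by (intro frac_le) auto
      then show "x \<in> (\<Union>n. {1 / real (Suc n)<..<real n})"
        using n m by (intro UN_I[of "max m n"]) auto
    next
      fix x :: real assume "x \<in> (\<Union>n. {1 / real (Suc n)<..<real n})"
      then obtain n where "1 / real (Suc n) < x" by auto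
      moreover have "0 < 1 / real (Suc n)" by simp
      ultimately show "x \<in> {0<..}" unfolding greaterThan_iff by (rule less_trans[rotated])
    qed
    show "emeasure S {1 / real (Suc i)<..<real i} \<noteq> \<infinity>" for i
      using radon_pos_interval_finite(2)[OF S, of "1 / real (Suc i)" "real i"] by simp
  qed (use eqE sets gen in auto)
qed


section \<open>Basic properties of quasi-concave functions\<close>

lemma quasi_concave_nonneg: "f \<in> quasi_concave \<Longrightarrow> 0 \<le> f x"
  by (simp add: quasi_concave_def)

lemma quasi_concave_level:
  assumes "f \<in> quasi_concave" "t > 0"
  shows "compact (super_level f t)" "convex (super_level f t)"
  using assms by (auto simp: quasi_concave_def convex_body_def)

lemma quasi_concaveI:
  assumes "\<And>x. 0 \<le> f x" "\<And>t. t > 0 \<Longrightarrow> compact (super_level f t) \<and> convex (super_level f t)"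
  shows "f \<in> quasi_concave"
  using assms by (auto simp: quasi_concave_def convex_body_def)

lemma quasi_concave_borel_measurable [measurable_dest]:
  fixes f :: "real ^ 'n \<Rightarrow> real"
  assumes "f \<in> quasi_concave"
  shows "f \<in> borel_measurable borel"
  unfolding borel_measurable_iff_ge
proof
  fix a
  show "{w \<in> space borel. a \<le> f w} \<in> sets borel"
  proof (cases "a > 0")
    case True
    then have "compact {w. a \<le> f w}" using quasi_concave_level(1)[OF assms True] by (simp add: super_level_def)
    then show ?thesis by (simp add: borel_closed compact_imp_closed)
  next
    case False
    then have "{w. a \<le> f w} = UNIV" using quasi_concave_nonneg[OF assms] by (auto simp: not_less intro: order_trans)
    then show ?thesis by simp
  qed
qed

text \<open>Otherwise the levels at heights 1, 2, ... are nested nonempty compact sets, and at a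
  common point the value of \<open>f\<close> would exceed every natural number.\<close>

lemma quasi_concave_bounded:
  fixes f :: "real ^ 'n \<Rightarrow> real"
  assumes f: "f \<in> quasi_concave"
  obtains B where "B > 0" "\<And>x. f x < B"
proof -
  have "\<exists>n. super_level f (Suc n) = {}"
  proof (rule ccontr)
    assume "\<not> ?thesis"
    then have "\<Inter>(range (\<lambda>n::nat. super_level f (Suc n))) \<noteq> {}"
      by (intro compact_nest quasi_concave_level[OF f]) (auto simp: super_level_def)
    then obtain x where "\<And>n::nat. Suc n \<le> f x" by (auto simp: super_level_def)
    moreover obtain n where "f x < real n" using reals_Archimedean2 by blast
    ultimately show False by (metis lessI less_imp_of_nat_less not_le order_less_trans)
  qed
  then obtain n where "super_level f (Suc n) = {}" ..
  then show thesis by (intro that[of "Suc n"]) (auto simp: super_level_def not_le)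
qed

lemma emeasure_super_level_finite:
  fixes f :: "real ^ 'n \<Rightarrow> real"
  assumes "f \<in> quasi_concave" "t > 0"
  shows "emeasure lborel (super_level f t) < \<infinity>"
  using quasi_concave_level(1)[OF assms] compact_imp_bounded emeasure_bounded_finite by blast

lemma super_level_borel:
  fixes f :: "real ^ 'n \<Rightarrow> real"
  assumes "f \<in> quasi_concave"
  shows "super_level f t \<in> sets borel"
proof -
  have [measurable]: "f \<in> borel_measurable borel" using assms by measurable
  show ?thesis unfolding super_level_def by simp
qed

section \<open>The image measure and its distributional identity\<close>

text \<open>Points where \<open>f\<close> vanishes are removed so that the image lives on the open
  half-line, as \<open>radon_pos\<close> demands.\<close>

definition level_measure :: "(real ^ 'n \<Rightarrow> real) \<Rightarrow> real measure" where
  "level_measure f = distr (restrict_space lborel {x. f x > 0}) (restrict_space borel {0<..}) f"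

lemma measurable_level_measure:
  fixes f :: "real ^ 'n \<Rightarrow> real"
  assumes "f \<in> quasi_concave"
  shows "f \<in> measurable (restrict_space lborel {x. f x > 0}) (restrict_space borel {0<..})"
  using quasi_concave_borel_measurable[OF assms] by (intro measurable_restrict_space3) auto

text \<open>Change of variables; \<open>c 0 = 0\<close> makes the integrand vanish off
  \<open>{x. f x > 0}\<close>, so the integral may run over the whole space.\<close>

lemma integral_level_measure:
  fixes f :: "real ^ 'n \<Rightarrow> real" and c :: "real \<Rightarrow> real"
  assumes f: "f \<in> quasi_concave" and c: "c \<in> borel_measurable (restrict_space borel {0<..})" and "c 0 = 0"
  shows "(LINT t|level_measure f. c t) = (LINT x|lborel. c (f x))"
proof -
  have [measurable]: "f \<in> borel_measurable borel" using f by measurable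
  have "(LINT t|level_measure f. c t) = (LINT x|restrict_space lborel {x. f x > 0}. c (f x))"
    unfolding level_measure_def by (rule integral_distr[OF measurable_level_measure[OF f] c])
  also have "\<dots> = (LINT x|lborel. indicator {x. f x > 0} x *\<^sub>R c (f x))"
    by (rule integral_restrict_space) simp
  also have "\<dots> = (LINT x|lborel. c (f x))"
  proof (rule Bochner_Integration.integral_cong[OF refl])
    fix x
    show "indicator {x. f x > 0} x *\<^sub>R c (f x) = c (f x)"
      using quasi_concave_nonneg[OF f, of x] \<open>c 0 = 0\<close> by (cases "f x = 0") (auto simp: indicator_def)
  qed
  finally show ?thesis .
qed

text \<open>A nonempty compact \<open>K\<close> in the open half-line has a least element
  \<open>m > 0\<close>, and its preimage lies in the compact level of \<open>f\<close> at
  \<open>m\<close>.\<close>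

lemma radon_pos_level_measure:
  fixes f :: "real ^ 'n \<Rightarrow> real"
  assumes f: "f \<in> quasi_concave"
  shows "radon_pos (level_measure f)"
  unfolding radon_pos_def
proof (intro conjI allI impI)
  show "sets (level_measure f) = sets (restrict_space borel {0<..})" by (simp add: level_measure_def)
  fix K :: "real set" assume K: "compact K \<and> K \<subseteq> {0<..}"
  show "emeasure (level_measure f) K < \<infinity>"
  proof (cases "K = {}")
    case False
    then obtain m where m: "m \<in> K" "\<And>x. x \<in> K \<Longrightarrow> m \<le> x" using compact_attains_inf[of K] K by auto
    then have "m > 0" using K by auto
    have [measurable]: "f \<in> borel_measurable borel" using f by measurable
    have "K \<in> sets (restrict_space borel {0<..})"
      using K by (subst sets_restrict_space_iff) (auto simp: borel_compact)
    then have "emeasure (level_measure f) K =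
        emeasure (restrict_space lborel {x. f x > 0}) (f -` K \<inter> space (restrict_space lborel {x. f x > 0}))"
      unfolding level_measure_def by (rule emeasure_distr[OF measurable_level_measure[OF f]])
    also have "\<dots> = emeasure lborel (f -` K \<inter> {x. f x > 0})"
      by (subst emeasure_restrict_space) (auto simp: space_restrict_space)
    also have "\<dots> \<le> emeasure lborel (super_level f m)"
      using m super_level_borel[OF f] by (intro emeasure_mono) (auto simp: super_level_def)
    also have "\<dots> < \<infinity>" using f \<open>m > 0\<close> by (rule emeasure_super_level_finite)
    finally show ?thesis .
  qed simp
qed

lemma test_function_support:
  assumes "\<phi> \<in> test_functions"
  obtains a b where "0 < a" "a < b" "\<And>t. t \<notin> {a..b} \<Longrightarrow> \<phi> t = 0" "\<And>t. t \<notin> {a..b} \<Longrightarrow> deriv \<phi> t = 0"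
proof -
  define K where "K = closure {t. \<phi> t \<noteq> 0}"
  have K: "compact K" "K \<subseteq> {0<..}" using assms by (auto simp: test_functions_def K_def)
  obtain a b where ab: "0 < a" "a < b" "K \<subseteq> {a..b}"
  proof (cases "K = {}")
    case True
    then show thesis by (intro that[of 1 2]) auto
  next
    case False
    obtain a where "a \<in> K" "\<And>x. x \<in> K \<Longrightarrow> a \<le> x" using compact_attains_inf[of K] K(1) False by auto
    moreover obtain b where "b \<in> K" "\<And>x. x \<in> K \<Longrightarrow> x \<le> b" using compact_attains_sup[of K] K(1) False by auto
    \<comment> \<open>The end \<open>b + 1\<close> makes the interval nondegenerate even if
      \<open>K\<close> is a single point.\<close>
    ultimately show thesis using K by (intro that[of a "b + 1"]) force+
  qed
  have zero: "\<phi> t = 0" if "t \<notin> K" for t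
    using that closure_subset[of "{t. \<phi> t \<noteq> 0}"] by (auto simp: K_def)
  have "deriv \<phi> t = 0" if "t \<notin> K" for t
  proof -
    have "eventually (\<lambda>s. s \<in> - K) (nhds t)"
      using that by (intro eventually_nhds_in_open) (auto simp: K_def)
    then have "eventually (\<lambda>s. \<phi> s = 0) (nhds t)" by eventually_elim (simp add: zero)
    then have "(\<phi> has_real_derivative 0) (at t)" by (subst DERIV_cong_ev[OF refl _ refl]) auto
    then show ?thesis by (rule DERIV_imp_deriv)
  qed
  with zero ab(3) show thesis by (intro that[OF ab(1,2)]) blast+
qed

text \<open>Layer-cake formula: integrate \<open>deriv \<phi> t\<close> over the region
  \<open>0 < t \<le> f x\<close>. Integrating first in \<open>t\<close> gives
  \<open>\<phi> (f x)\<close>, integrating first in \<open>x\<close> gives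
  \<open>deriv \<phi> t\<close> times the volume of the level.\<close>

lemma level_measure_distributional:
  fixes f :: "real ^ 'n \<Rightarrow> real"
  assumes f: "f \<in> quasi_concave" and \<phi>: "\<phi> \<in> test_functions"
  shows "(LINT t:{0<..}|lborel. deriv \<phi> t * level_volume f t) = (LINT t|level_measure f. \<phi> t)"
proof -
  have [measurable]: "f \<in> borel_measurable borel" using f by measurable
  obtain a b where ab: "0 < a" "a < b"
    and supp: "\<And>t. t \<notin> {a..b} \<Longrightarrow> \<phi> t = 0" "\<And>t. t \<notin> {a..b} \<Longrightarrow> deriv \<phi> t = 0"
    using test_function_support[OF \<phi>] by blast
  have diff: "((deriv ^^ k) \<phi>) differentiable (at x)" for k x using \<phi> by (auto simp: test_functions_def)
  have der: "(\<phi> has_real_derivative deriv \<phi> t) (at t)" for t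
    using diff[of 0 t] by (simp add: DERIV_deriv_iff_real_differentiable)
  have cont: "continuous_on UNIV (deriv \<phi>)"
    using diff[of 1] by (simp add: differentiable_on_def differentiable_imp_continuous_on differentiable_at_withinI)
  have [measurable]: "deriv \<phi> \<in> borel_measurable borel" using cont by (rule borel_measurable_continuous_onI)
  have "continuous_on UNIV \<phi>" using der by (rule DERIV_continuous_on)
  then have [measurable]: "\<phi> \<in> borel_measurable borel" by (rule borel_measurable_continuous_onI)
  have "compact (deriv \<phi> ` {a..b})" using cont continuous_on_subset by (intro compact_continuous_image) blast+
  then have "\<exists>C. \<forall>t\<in>{a..b}. \<bar>deriv \<phi> t\<bar> \<le> C"
    by (auto dest!: compact_imp_bounded simp: bounded_iff)
  then obtain C where C: "\<And>t. t \<in> {a..b} \<Longrightarrow> \<bar>deriv \<phi> t\<bar> \<le> C" by blast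
  define h where "h x t = deriv \<phi> t * indicator {0<..f x} t" for x t
  have [measurable]: "case_prod h \<in> borel_measurable (lborel \<Otimes>\<^sub>M lborel)"
  proof -
    have "case_prod h = (\<lambda>p. deriv \<phi> (snd p) * (if 0 < snd p \<and> snd p \<le> f (fst p) then 1 else 0))"
      by (auto simp: h_def indicator_def fun_eq_iff)
    also have "\<dots> \<in> borel_measurable (lborel \<Otimes>\<^sub>M lborel)" by measurable
    finally show ?thesis .
  qed
  have int: "integrable (lborel \<Otimes>\<^sub>M lborel) (case_prod h)"
  proof (rule integrableI_bounded_set[where A = "super_level f a \<times> {a..b}" and B = C])
    show "super_level f a \<times> {a..b} \<in> sets (lborel \<Otimes>\<^sub>M lborel)" using super_level_borel[OF f] by simp
    have "emeasure (lborel \<Otimes>\<^sub>M lborel) (super_level f a \<times> {a..b}) =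
        emeasure lborel (super_level f a) * emeasure lborel {a..b}"
      using super_level_borel[OF f] by (intro lborel.emeasure_pair_measure_Times) auto
    also have "\<dots> < \<infinity>"
      using emeasure_super_level_finite[OF f ab(1)] ab by (simp add: ennreal_mult_less_top)
    finally show "emeasure (lborel \<Otimes>\<^sub>M lborel) (super_level f a \<times> {a..b}) < \<infinity>" .
    show "AE p in lborel \<Otimes>\<^sub>M lborel. p \<in> super_level f a \<times> {a..b} \<longrightarrow> norm (case_prod h p) \<le> C"
    proof (rule AE_I2, safe)
      fix x t assume "t \<in> {a..b}"
      then have "\<bar>deriv \<phi> t\<bar> \<le> C" by (rule C)
      then show "norm (h x t) \<le> C" by (auto simp: h_def indicator_def)
    qed
    show "AE p in lborel \<Otimes>\<^sub>M lborel. p \<notin> super_level f a \<times> {a..b} \<longrightarrow> case_prod h p = 0"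
    proof (rule AE_I2, rule impI)
      fix p assume p: "p \<notin> super_level f a \<times> {a..b}"
      obtain x t where [simp]: "p = (x, t)" by (cases p)
      show "case_prod h p = 0"
        using p supp(2)[of t] by (cases "t \<in> {a..b}") (auto simp: h_def indicator_def super_level_def)
    qed
  qed measurable
  have inner1: "(LINT t|lborel. h x t) = \<phi> (f x)" for x
  proof (cases "f x \<ge> a")
    case True
    \<comment> \<open>The integration starts at \<open>a/2\<close>, where \<open>\<phi>\<close> is
      known to vanish; at \<open>a\<close> itself the support condition says nothing.\<close>
    have "(LINT t|lborel. h x t) = (LINT t|lborel. indicator {a/2..f x} t *\<^sub>R deriv \<phi> t)"
      using supp(2) ab by (intro Bochner_Integration.integral_cong) (auto simp: h_def indicator_def not_le)
    also have "\<dots> = \<phi> (f x) - \<phi> (a/2)"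
      using True ab der cont by (intro integral_FTC_atLeastAtMost)
        (auto simp: has_real_derivative_iff_has_vector_derivative[symmetric]
          intro: has_field_derivative_at_within continuous_on_subset)
    also have "\<phi> (a/2) = 0" using ab by (intro supp) auto
    finally show ?thesis by simp
  next
    case False
    then have "h x t = 0" for t using supp(2)[of t] by (auto simp: h_def indicator_def)
    moreover have "\<phi> (f x) = 0" using False by (intro supp) auto
    ultimately show ?thesis by simp
  qed
  have inner2: "(LINT x|lborel. h x t) = indicator {0<..} t *\<^sub>R (deriv \<phi> t * level_volume f t)" for t
  proof (cases "t > 0")
    case True
    have "(LINT x|lborel. h x t) = (LINT x|lborel. deriv \<phi> t * indicator (super_level f t) x)"
      using True by (intro Bochner_Integration.integral_cong) (auto simp: h_def super_level_def indicator_def)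
    also have "\<dots> = deriv \<phi> t * measure lborel (super_level f t)"
      using super_level_borel[OF f] emeasure_super_level_finite[OF f True] by simp
    also have "measure lborel (super_level f t) = level_volume f t"
      unfolding level_volume_def using super_level_borel[OF f] by (simp add: measure_completion)
    finally show ?thesis using True by simp
  qed (simp add: h_def)
  have "(LINT t:{0<..}|lborel. deriv \<phi> t * level_volume f t) = (LINT t|lborel. LINT x|lborel. h x t)"
    unfolding set_lebesgue_integral_def inner2 ..
  also have "\<dots> = (LINT x|lborel. LINT t|lborel. h x t)"
    using int by (rule lborel_pair.Fubini_integral)
  also have "\<dots> = (LINT t|level_measure f. \<phi> t)"
    unfolding inner1 using ab supp(1)[of 0]
    by (intro integral_level_measure[OF f, symmetric] measurable_restrict_space1) auto
  finally show ?thesis .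
qed

text \<open>The image measure has the defining property, and \<open>radon_pos_eqI\<close> makes it
  the only such measure, so the definite description denotes it.\<close>

lemma S_N_eq_level_measure:
  fixes f :: "real ^ 'n \<Rightarrow> real"
  assumes f: "f \<in> quasi_concave"
  shows "S_N f = level_measure f"
  unfolding S_N_def
proof (rule the_equality)
  show "radon_pos (level_measure f) \<and> (\<forall>\<phi>\<in>test_functions.
      (LINT t:{0<..}|lborel. deriv \<phi> t * level_volume f t) = (LINT t|level_measure f. \<phi> t))"
    using radon_pos_level_measure[OF f] level_measure_distributional[OF f] by blast
next
  fix S assume "radon_pos S \<and> (\<forall>\<phi>\<in>test_functions.
      (LINT t:{0<..}|lborel. deriv \<phi> t * level_volume f t) = (LINT t|S. \<phi> t))"
  then show "S = level_measure f"
    using radon_pos_level_measure[OF f] level_measure_distributional[OF f] by (intro radon_pos_eqI) auto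
qed

section \<open>Valuations on quasi-concave functions\<close>

abbreviation level_fun :: "real \<Rightarrow> 'a set \<Rightarrow> 'a \<Rightarrow> real" where
  "level_fun t K \<equiv> \<lambda>x. t * indicator K x"

lemma super_level_level_fun:
  assumes "s > 0"
  shows "super_level (level_fun t K) s = (if s \<le> t then K else {})"
  using assms by (auto simp: super_level_def indicator_def)

lemma super_level_max: "super_level (\<lambda>x. max (f x) (g x)) t = super_level f t \<union> super_level g t"
  by (auto simp: super_level_def le_max_iff_disj)

lemma level_fun_quasi_concave:
  assumes "0 \<le> t" "compact_convex K"
  shows "level_fun t K \<in> quasi_concave"
  using assms by (intro quasi_concaveI) (auto simp: super_level_level_fun)

lemma max_level_fun:
  assumes "0 \<le> (t::real)"
  shows "(\<lambda>x. max (level_fun t K x) (level_fun t L x)) = level_fun t (K \<union> L)"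
  using assms by (auto simp: indicator_def fun_eq_iff)

lemma min_level_fun:
  assumes "0 \<le> (t::real)"
  shows "(\<lambda>x. min (level_fun t K x) (level_fun t L x)) = level_fun t (K \<inter> L)"
  using assms by (auto simp: indicator_def fun_eq_iff)

locale volume_degree_valuation =
  fixes \<mu> :: "(real ^ 'n \<Rightarrow> real) \<Rightarrow> real"
  assumes continuous_valuation: "continuous_valuation \<mu>"
    and translation_invariant: "translation_invariant \<mu>"
    and homogeneous: "homogeneous CARD('n) \<mu>"
begin

lemma zero [simp]: "\<mu> (\<lambda>x. 0) = 0"
  using continuous_valuation by (simp add: continuous_valuation_def valuation_def)

lemma max_min:
  assumes "f \<in> quasi_concave" "g \<in> quasi_concave" "(\<lambda>x. max (f x) (g x)) \<in> quasi_concave"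
  shows "\<mu> (\<lambda>x. max (f x) (g x)) + \<mu> (\<lambda>x. min (f x) (g x)) = \<mu> f + \<mu> g"
  using continuous_valuation assms by (simp add: continuous_valuation_def valuation_def)

lemma continuous_incseq:
  assumes "f \<in> quasi_concave" "\<And>i. F i \<in> quasi_concave" "\<And>x. (\<lambda>i. F i x) \<longlonglongrightarrow> f x"
    "\<And>x. incseq (\<lambda>i. F i x)"
  shows "(\<lambda>i. \<mu> (F i)) \<longlonglongrightarrow> \<mu> f"
  using continuous_valuation assms by (simp add: continuous_valuation_def)

lemma continuous_decseq:
  assumes "f \<in> quasi_concave" "\<And>i. F i \<in> quasi_concave" "\<And>x. (\<lambda>i. F i x) \<longlonglongrightarrow> f x"
    "\<And>x. decseq (\<lambda>i. F i x)"
  shows "(\<lambda>i. \<mu> (F i)) \<longlonglongrightarrow> \<mu> f"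
  using continuous_valuation assms by (simp add: continuous_valuation_def)

text \<open>For a fixed height, maximum and minimum of such functions correspond to union and
  intersection of the bodies, and translations, dilations and decreasing limits carry over in the
  same way.\<close>

lemma homogeneous_body_valuation_level_fun:
  assumes t: "0 \<le> t"
  shows "homogeneous_body_valuation (\<lambda>K. \<mu> (level_fun t K)) DIM(real ^ 'n)"
proof
  fix K L :: "(real ^ 'n) set" assume KL: "compact_convex K" "compact_convex L" "convex (K \<union> L)"
  then have "level_fun t (K \<union> L) \<in> quasi_concave"
    using t by (intro level_fun_quasi_concave) auto
  then show "\<mu> (level_fun t (K \<union> L)) + \<mu> (level_fun t (K \<inter> L)) = \<mu> (level_fun t K) + \<mu> (level_fun t L)"
    using max_min[OF level_fun_quasi_concave[OF t KL(1)] level_fun_quasi_concave[OF t KL(2)]]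
    by (simp only: max_level_fun[OF t] min_level_fun[OF t])
next
  fix K :: "(real ^ 'n) set" and v assume K: "compact_convex K"
  have "level_fun t ((+) v ` K) = level_fun t K \<circ> (\<lambda>x. x + (- v))"
    by (auto simp: fun_eq_iff indicator_def image_iff algebra_simps) (metis add_diff_cancel_left' diff_add_cancel add.commute)+
  then show "\<mu> (level_fun t ((+) v ` K)) = \<mu> (level_fun t K)"
    using translation_invariant level_fun_quasi_concave[OF t K]
    unfolding translation_invariant_def by metis
next
  fix K :: "(real ^ 'n) set" and r :: real assume K: "compact_convex K" and r: "r > 0"
  have "level_fun t ((*\<^sub>R) r ` K) = (\<lambda>x. level_fun t K (x /\<^sub>R r))"
  proof
    fix x
    have "x \<in> (*\<^sub>R) r ` K \<longleftrightarrow> x /\<^sub>R r \<in> K"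
      using r by (auto simp: image_iff intro!: bexI[of _ "x /\<^sub>R r"])
    then show "level_fun t ((*\<^sub>R) r ` K) x = level_fun t K (x /\<^sub>R r)" by (simp add: indicator_def)
  qed
  moreover have "\<mu> (\<lambda>x. level_fun t K (x /\<^sub>R r)) = r ^ CARD('n) * \<mu> (level_fun t K)"
    using homogeneous[unfolded homogeneous_def, rule_format, OF level_fun_quasi_concave[OF t K] r] .
  ultimately show "\<mu> (level_fun t ((*\<^sub>R) r ` K)) = r ^ DIM(real ^ 'n) * \<mu> (level_fun t K)"
    by (simp only: DIM_cart DIM_real mult_1_right)
next
  fix X :: "nat \<Rightarrow> (real ^ 'n) set" assume X: "\<And>i. compact_convex (X i)" "decseq X"
  have X_compact: "compact_convex (\<Inter>i. X i)"
    using X by (intro conjI compact_Inter convex_INT) auto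
  show "(\<lambda>i. \<mu> (level_fun t (X i))) \<longlonglongrightarrow> \<mu> (level_fun t (\<Inter>i. X i))"
  proof (rule continuous_decseq)
    show "(\<lambda>i. level_fun t (X i) x) \<longlonglongrightarrow> level_fun t (\<Inter>i. X i) x" for x
      using X(2) by (intro tendsto_mult_left LIMSEQ_indicator_decseq)
    show "decseq (\<lambda>i. level_fun t (X i) x)" for x
      using X(2) t by (auto simp: decseq_def indicator_def)
  qed (use X X_compact t level_fun_quasi_concave in auto)
qed simp

text \<open>The unit cube has volume 1, so this is the factor of the volume at height
  \<open>t\<close>, that is, the density \<open>c\<close> of the theorem.\<close>

definition profile :: "real \<Rightarrow> real" where
  "profile t = \<mu> (level_fun t (cbox 0 One))"

lemma profile_0: "profile 0 = 0"
  by (simp add: profile_def)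

lemma level_fun_eq_profile:
  assumes "0 \<le> t" "compact_convex K"
  shows "\<mu> (level_fun t K) = profile t * measure lebesgue K"
  using homogeneous_body_valuation.eq_volume[OF homogeneous_body_valuation_level_fun[OF assms(1)] refl assms(2)]
  by (simp add: profile_def)

lemma unit_cube: "compact_convex (cbox 0 (One :: real ^ 'n))"
  by simp

text \<open>Heights converging monotonically to \<open>t\<close> give pointwise monotone sequences
  of functions on the cube, so monotone continuity yields both one-sided limits.\<close>

lemma isCont_profile:
  assumes t: "t > 0"
  shows "isCont profile t"
proof -
  have lim: "(\<lambda>i. level_fun (S i) (cbox 0 One) x) \<longlonglongrightarrow> level_fun t (cbox 0 One) x"
    if "S \<longlonglongrightarrow> t" for S and x :: "real ^ 'n"
    using that by (intro tendsto_mult_right)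
  have "(profile \<longlongrightarrow> profile t) (at_left t)"
  proof (rule tendsto_at_left_sequentially[OF t])
    fix S assume S: "\<And>n::nat. S n < t" "\<And>n. 0 < S n" "incseq S" "S \<longlonglongrightarrow> t"
    have S': "0 \<le> S n" for n using S(2)[of n] by simp
    show "(\<lambda>n. profile (S n)) \<longlonglongrightarrow> profile t"
      unfolding profile_def
      by (rule continuous_incseq)
         (use t S S' lim unit_cube in \<open>auto intro!: level_fun_quasi_concave simp: incseq_def mult_right_mono\<close>)
  qed
  moreover have "(profile \<longlongrightarrow> profile t) (at_right t)"
  proof (rule tendsto_at_right_sequentially[of t "t + 1"])
    fix S assume S: "\<And>n::nat. t < S n" "\<And>n. S n < t + 1" "decseq S" "S \<longlonglongrightarrow> t"
    have S': "0 \<le> S n" for n using S(1)[of n] t by simp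
    show "(\<lambda>n. profile (S n)) \<longlonglongrightarrow> profile t"
      unfolding profile_def
      by (rule continuous_decseq)
         (use t S S' lim unit_cube in \<open>auto intro!: level_fun_quasi_concave simp: decseq_def mult_right_mono\<close>)
  qed simp
  ultimately show ?thesis by (simp add: isCont_def filterlim_split_at)
qed

text \<open>Otherwise, stack cubes of rapidly increasing sizes \<open>s i\<close> at heights \<open>t i\<close>
  decreasing to zero: the functional would change by at least one at each step, although the
  resulting functions increase to a member of \<open>quasi_concave\<close>.\<close>
lemma profile_vanishes_near_0:
  "\<exists>\<delta>>0. \<forall>t\<in>{0..\<delta>}. profile t = 0"
proof (rule ccontr)
  assume none: "\<not> ?thesis"
  have ex: "\<exists>t. 0 < t \<and> t < e \<and> profile t \<noteq> 0" if "e > 0" for e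
  proof -
    have "\<not> (\<forall>t\<in>{0..e/2}. profile t = 0)"
    proof
      assume "\<forall>t\<in>{0..e/2}. profile t = 0"
      then have "\<exists>\<delta>>0. \<forall>t\<in>{0..\<delta>}. profile t = 0" using that by (intro exI[of _ "e/2"]) simp
      with none show False ..
    qed
    then obtain t where "t \<in> {0..e/2}" "profile t \<noteq> 0" by blast
    then show ?thesis using that profile_0 by (intro exI[of _ t]) (cases "t = 0"; auto)
  qed
  \<comment> \<open>A pair consists of a height and the side length of a cube. \<open>R\<close> asks
    that the height more than halve, that the cube not shrink, and that the value of
    \<open>\<mu>\<close> jump by at least 1.\<close>
  define P where "P n p \<longleftrightarrow> 0 < fst p \<and> 0 < snd p" for n :: nat and p :: "real \<times> real"
  define R where "R n p q \<longleftrightarrow> fst q < fst p / 2 \<and> snd p \<le> snd q \<and>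
      \<bar>profile (fst q)\<bar> * (snd q ^ CARD('n) - snd p ^ CARD('n)) \<ge> 1"
    for n :: nat and p q :: "real \<times> real"
  have "\<exists>p. \<forall>n. P n (p n) \<and> R n (p n) (p (Suc n))"
  proof (rule dependent_nat_choice)
    show "\<exists>p. P 0 p" by (intro exI[of _ "(1, 1)"]) (simp add: P_def)
    fix p n assume p: "P n p"
    obtain t where t: "0 < t" "t < fst p / 2" "profile t \<noteq> 0"
      using ex[of "fst p / 2"] p by (auto simp: P_def)
    \<comment> \<open>Since \<open>s \<ge> 1\<close>, the power \<open>s ^ CARD('n)\<close> is at
      least \<open>s\<close>; the other summands then give the required excess over the previous
      volume.\<close>
    define s where "s = max 1 (snd p) + snd p ^ CARD('n) + 1 / \<bar>profile t\<bar>"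
    have s: "1 \<le> s" "snd p \<le> s" "snd p ^ CARD('n) + 1 / \<bar>profile t\<bar> \<le> s"
      using p by (auto simp: s_def P_def add_increasing2)
    have "s \<le> s ^ CARD('n)" using s(1) by (intro self_le_power) auto
    then have "1 / \<bar>profile t\<bar> \<le> s ^ CARD('n) - snd p ^ CARD('n)" using s(3) by linarith
    then have "\<bar>profile t\<bar> * (s ^ CARD('n) - snd p ^ CARD('n)) \<ge> 1"
      using t(3) by (simp add: field_simps)
    then show "\<exists>q. P (Suc n) q \<and> R n p q"
      using t s by (intro exI[of _ "(t, s)"]) (auto simp: P_def R_def)
  qed
  then obtain p where p: "\<And>n. P n (p n)" "\<And>n. R n (p n) (p (Suc n))" by blast
  define t where "t n = fst (p n)" for n
  define s where "s n = snd (p n)" for n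
  define K where "K n = cbox 0 (s n *\<^sub>R One :: real ^ 'n)" for n
  have t_pos: "0 < t n" and s_pos: "0 < s n" for n using p(1)[of n] by (auto simp: P_def t_def s_def)
  have t_Suc: "t (Suc n) < t n / 2" and s_Suc: "s n \<le> s (Suc n)"
    and jump: "1 \<le> \<bar>profile (t (Suc n))\<bar> * (s (Suc n) ^ CARD('n) - s n ^ CARD('n))" for n
    using p(2)[of n] by (auto simp: R_def t_def s_def)
  have K: "compact_convex (K n)" for n by (simp add: K_def)
  have K_Suc: "K n \<subseteq> K (Suc n)" for n
    unfolding K_def using s_Suc[of n] by (auto simp: subset_box)
  have vol_K: "measure lebesgue (K n) = s n ^ CARD('n)" for n
    using s_pos[of n] by (simp add: K_def measure_completion content_cbox_cart content_cbox)
  \<comment> \<open>A stepped pyramid: each new cube contains the previous ones and is placed at a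
    lower height.\<close>
  define f where "f = rec_nat (level_fun (t 0) (K 0)) (\<lambda>n g x. max (g x) (level_fun (t (Suc n)) (K (Suc n)) x))"
  have f_0: "f 0 = level_fun (t 0) (K 0)"
    and f_Suc: "f (Suc n) = (\<lambda>x. max (f n x) (level_fun (t (Suc n)) (K (Suc n)) x))" for n
    by (auto simp: f_def)
  have f_in: "t n \<le> f n x" if "x \<in> K n" for n x
    using that by (cases n) (auto simp: f_0 f_Suc)
  have f_out: "f n x = 0" if "x \<notin> K n" for n x
    using that
  proof (induction n)
    case (Suc n)
    then have "f n x = 0" using K_Suc[of n] by auto
    then show ?case using Suc by (simp add: f_Suc)
  qed (simp add: f_0)
  have f_nonneg: "0 \<le> f n x" for n x
    using f_in[of x n] f_out[of x n] t_pos[of n] by (cases "x \<in> K n") auto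
  have f_qc: "f n \<in> quasi_concave" for n
  proof (induction n)
    case 0
    show ?case unfolding f_0 using t_pos[of 0] K[of 0] by (intro level_fun_quasi_concave) auto
  next
    case (Suc n)
    show ?case
    proof (rule quasi_concaveI)
      fix r :: real assume r: "r > 0"
      have *: "super_level (f (Suc n)) r = super_level (f n) r \<union> (if r \<le> t (Suc n) then K (Suc n) else {})"
        unfolding f_Suc super_level_max super_level_level_fun[OF r] ..
      have "super_level (f n) r \<subseteq> K n"
      proof
        fix x assume "x \<in> super_level (f n) r"
        then have "f n x \<noteq> 0" using r by (simp add: super_level_def)
        then show "x \<in> K n" using f_out by blast
      qed
      then have "super_level (f (Suc n)) r = (if r \<le> t (Suc n) then K (Suc n) else super_level (f n) r)"
        unfolding * using K_Suc[of n] by auto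
      then show "compact (super_level (f (Suc n)) r) \<and> convex (super_level (f (Suc n)) r)"
        using K[of "Suc n"] quasi_concave_level[OF Suc r] by simp
    qed (rule f_nonneg)
  qed
  have step: "\<mu> (f (Suc n)) - \<mu> (f n) = profile (t (Suc n)) * (s (Suc n) ^ CARD('n) - s n ^ CARD('n))" for n
  proof -
    \<comment> \<open>On \<open>K n\<close> the old function lies above the new height and outside
      it is zero. Hence the change of \<open>\<mu>\<close> is the new density times the gain in
      volume.\<close>
    have "(\<lambda>x. min (f n x) (level_fun (t (Suc n)) (K (Suc n)) x)) = level_fun (t (Suc n)) (K n)"
    proof
      fix x
      show "min (f n x) (level_fun (t (Suc n)) (K (Suc n)) x) = level_fun (t (Suc n)) (K n) x"
        using f_in[of x n] f_out[of x n] K_Suc[of n] t_Suc[of n] t_pos[of n] t_pos[of "Suc n"]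
        by (cases "x \<in> K n") (auto simp: indicator_def)
    qed
    moreover have "\<mu> (level_fun (t (Suc n)) (K m)) = profile (t (Suc n)) * s m ^ CARD('n)" for m
      using level_fun_eq_profile[of "t (Suc n)" "K m"] t_pos[of "Suc n"] K vol_K by simp
    moreover have "level_fun (t (Suc n)) (K (Suc n)) \<in> quasi_concave"
      using t_pos[of "Suc n"] K by (intro level_fun_quasi_concave) auto
    ultimately show ?thesis
      using max_min[OF f_qc[of n], of "level_fun (t (Suc n)) (K (Suc n))"] f_qc[of "Suc n"]
      by (simp add: f_Suc algebra_simps)
  qed
  have t_dec: "decseq t" using t_Suc t_pos by (intro decseq_SucI) (smt (verit) field_sum_of_halves)
  have t_le: "t n \<le> t 0 * (1/2)^n" for n
  proof (induction n)
    case (Suc n)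
    then show ?case using t_Suc[of n] by simp
  qed simp
  have f_inc: "incseq (\<lambda>n. f n x)" for x by (rule incseq_SucI) (simp add: f_Suc)
  \<comment> \<open>Stages after \<open>n\<close> add nothing above the height
    \<open>t (Suc n)\<close>. Consequently every positive level of the limit is a level of some
    \<open>f n\<close>, which makes the limit quasi-concave.\<close>
  have f_later: "f (n + m) x \<le> max (f n x) (t (Suc n))" for n m x
  proof (induction m)
    case (Suc m)
    have "t (Suc (n + m)) \<le> t (Suc n)" using t_dec by (simp add: decseq_def)
    then have "level_fun (t (Suc (n + m))) (K (Suc (n + m))) x \<le> t (Suc n)"
      using t_pos[of "Suc n"] by (auto simp: indicator_def)
    then show ?case using Suc by (simp add: f_Suc)
  qed simp
  define g where "g x = lim (\<lambda>n. f n x)" for x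
  have conv: "(\<lambda>n. f n x) \<longlonglongrightarrow> g x" for x
  proof -
    have "\<bar>f n x\<bar> \<le> max (f 0 x) (t 1)" for n using f_later[of 0 n x] f_nonneg[of n x] by simp
    then have "Bseq (\<lambda>n. f n x)" by (intro BseqI') auto
    then show ?thesis
      unfolding g_def using f_inc by (simp add: Bseq_monoseq_convergent incseq_imp_monoseq convergent_LIMSEQ_iff[symmetric])
  qed
  have g_ge: "f n x \<le> g x" for n x using incseq_le[OF f_inc conv] .
  have g_le: "g x \<le> max (f n x) (t (Suc n))" for n x
    by (rule LIMSEQ_le_const2[OF LIMSEQ_ignore_initial_segment[OF conv, of n x]])
       (use f_later[of n] in \<open>auto simp: add.commute\<close>)
  have "g \<in> quasi_concave"
  proof (rule quasi_concaveI)
    show "0 \<le> g x" for x using f_nonneg[of 0 x] g_ge[of 0 x] by simp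
    fix r :: real assume r: "r > 0"
    have "(\<lambda>n. t 0 * (1/2)^n) \<longlonglongrightarrow> t 0 * 0" by (intro tendsto_intros) auto
    then have "eventually (\<lambda>n. t 0 * (1/2)^n < r) sequentially" using r by (intro order_tendstoD) auto
    then obtain n where "t 0 * (1/2)^n < r" by (auto simp: eventually_sequentially)
    then have "t n < r" using t_le[of n] by simp
    then have "t (Suc n) < r" using t_Suc[of n] t_pos[of n] by simp
    then have "super_level g r = super_level (f n) r"
      using g_ge[of n] g_le[of _ n] unfolding super_level_def
      by (smt (verit) Collect_cong max_def)
    then show "compact (super_level g r) \<and> convex (super_level g r)"
      using quasi_concave_level[OF f_qc r] by simp
  qed
  then have lim: "(\<lambda>n. \<mu> (f n)) \<longlonglongrightarrow> \<mu> g"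
    using f_qc conv f_inc by (rule continuous_incseq)
  \<comment> \<open>Increments of a convergent sequence tend to zero, against the jumps of size at
    least 1.\<close>
  have "(\<lambda>n. \<mu> (f (Suc n)) - \<mu> (f n)) \<longlonglongrightarrow> \<mu> g - \<mu> g"
    by (intro tendsto_diff LIMSEQ_Suc lim)
  then have "(\<lambda>n. \<bar>\<mu> (f (Suc n)) - \<mu> (f n)\<bar>) \<longlonglongrightarrow> 0" by (simp add: tendsto_rabs_zero)
  moreover have "1 \<le> \<bar>\<mu> (f (Suc n)) - \<mu> (f n)\<bar>" for n
    using jump[of n] s_Suc[of n] s_pos[of n] power_mono[of "s n" "s (Suc n)" "CARD('n)"]
    unfolding step abs_mult by simp
  ultimately have "(1::real) \<le> 0" by (intro LIMSEQ_le_const) auto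
  then show False by simp
qed

lemma continuous_on_profile: "continuous_on {0..} profile"
  unfolding continuous_on_eq_continuous_within
proof
    fix t :: real assume t: "t \<in> {0..}"
    show "continuous (at t within {0..}) profile"
    proof (cases "t = 0")
      case True
      obtain \<delta> where "\<delta> > 0" "\<forall>t\<in>{0..\<delta>}. profile t = 0" using profile_vanishes_near_0 by blast
      then have "eventually (\<lambda>s. profile s = 0) (at 0 within {0..})"
        unfolding eventually_at by (intro exI[of _ \<delta>]) auto
      then have "(profile \<longlongrightarrow> 0) (at 0 within {0..})" by (rule tendsto_eventually)
      then show ?thesis using True by (simp add: continuous_within profile_0)
    next
      case False
      then show ?thesis using t isCont_profile[of t] by (auto intro: continuous_at_imp_continuous_at_within)
    qed
qed

section \<open>The integral representation\<close>

lemma borel_measurable_profile_comp: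
  fixes f :: "real ^ 'n \<Rightarrow> real"
  assumes "f \<in> borel_measurable borel" "\<And>x. 0 \<le> f x"
  shows "(\<lambda>x. profile (f x)) \<in> borel_measurable borel"
proof -
  \<comment> \<open>Continuity is available on \<open>{0..}\<close> only; composing with
    \<open>max 0\<close> extends it to the line without changing the values at
    \<open>f x\<close>.\<close>
  have "continuous_on UNIV (\<lambda>t. profile (max 0 t))"
    by (rule continuous_on_compose2[OF continuous_on_profile]) (auto intro!: continuous_intros)
  then have "(\<lambda>x. profile (max 0 (f x))) \<in> borel_measurable borel"
    using assms(1) by (rule borel_measurable_continuous_on)
  then show ?thesis using assms(2) by (simp add: max_absorb2)
qed

lemma profile_bound:
  obtains C where "\<And>t. t \<in> {0..B} \<Longrightarrow> \<bar>profile t\<bar> \<le> C"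
proof -
  have "compact (profile ` {0..B})"
    by (intro compact_continuous_image continuous_on_subset[OF continuous_on_profile]) auto
  then have "\<exists>C. \<forall>t\<in>{0..B}. \<bar>profile t\<bar> \<le> C"
    by (auto dest!: compact_imp_bounded simp: bounded_iff)
  then show thesis using that by blast
qed

text \<open>As the density vanishes on \<open>{0..\<delta>}\<close>, the integrand is supported in a
  level of \<open>f\<close>, which has finite measure, and it is bounded because \<open>f\<close>
  is.\<close>

lemma integrable_profile_comp:
  fixes f :: "real ^ 'n \<Rightarrow> real"
  assumes f: "f \<in> quasi_concave"
  shows "integrable lborel (\<lambda>x. profile (f x))"
proof -
  obtain \<delta> where \<delta>: "\<delta> > 0" "\<And>t. t \<in> {0..\<delta>} \<Longrightarrow> profile t = 0" using profile_vanishes_near_0 by blast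
  obtain B where B: "\<And>x. f x < B" using quasi_concave_bounded[OF f] by blast
  obtain C where C: "\<And>t. t \<in> {0..B} \<Longrightarrow> \<bar>profile t\<bar> \<le> C" using profile_bound by blast
  have f0: "0 \<le> f x" for x using f by (rule quasi_concave_nonneg)
  show ?thesis
  proof (rule integrableI_bounded_set[where A = "super_level f \<delta>" and B = C])
    show "(\<lambda>x. profile (f x)) \<in> borel_measurable lborel"
      using borel_measurable_profile_comp[OF quasi_concave_borel_measurable[OF f] f0] by simp
    show "AE x in lborel. x \<in> super_level f \<delta> \<longrightarrow> norm (profile (f x)) \<le> C"
      using C B f0 by (auto intro!: AE_I2 C simp: less_imp_le)
    show "AE x in lborel. x \<notin> super_level f \<delta> \<longrightarrow> profile (f x) = 0"
      using \<delta>(2) f0 by (auto intro!: AE_I2 simp: super_level_def not_le less_imp_le)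
  qed (use super_level_borel[OF f] emeasure_super_level_finite[OF f \<delta>(1)] in auto)
qed

lemma integral_profile_level_fun:
  assumes "0 \<le> t" "compact_convex (K :: (real ^ 'n) set)"
  shows "(LINT x|lborel. profile (level_fun t K x)) = profile t * measure lebesgue K"
proof -
  have K: "K \<in> sets borel" "emeasure lborel K < \<infinity>"
    using assms borel_compact compact_imp_bounded emeasure_bounded_finite by auto
  have "(LINT x|lborel. profile (level_fun t K x)) = (LINT x|lborel. profile t * indicator K x)"
    by (intro Bochner_Integration.integral_cong) (auto simp: indicator_def profile_0)
  also have "\<dots> = profile t * measure lebesgue K" using K by (simp add: measure_completion)
  finally show ?thesis .
qed

text \<open>Here \<open>h j\<close> is \<open>f\<close> rounded down to multiples of
  \<open>1 / m\<close> and capped at \<open>j / m\<close>. Raising the cap takes the maximum with a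
  multiple of the indicator of one level \<open>L\<close>; the corresponding minimum is again such a
  multiple. Both sides satisfy the valuation identity and agree on these multiples, so induction on
  \<open>j\<close> applies.\<close>

lemma truncated_floor_eq_integral:
  fixes f :: "real ^ 'n \<Rightarrow> real" and m :: real and j :: nat
  assumes f: "f \<in> quasi_concave" and m: "m > 0"
  defines "h \<equiv> \<lambda>j x. of_int (min \<lfloor>m * f x\<rfloor> (int j)) / m"
  shows "h j \<in> quasi_concave \<and> \<mu> (h j) = (LINT x|lborel. profile (h j x))"
proof -
  have f0: "0 \<le> f x" for x using f by (rule quasi_concave_nonneg)
  have qc: "h j \<in> quasi_concave" for j
  proof (rule quasi_concaveI)
    show "0 \<le> h j x" for x using f0 m by (simp add: h_def)
    fix t :: real assume t: "t > 0"
    \<comment> \<open>Rounding replaces a level at \<open>t\<close> by the level of \<open>f\<close>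
      at the next multiple of \<open>1 / m\<close>, or by the empty set above the cap.\<close>
    have "t \<le> h j x \<longleftrightarrow> \<lceil>m * t\<rceil> \<le> int j \<and> of_int \<lceil>m * t\<rceil> / m \<le> f x" for x
    proof -
      have "t \<le> h j x \<longleftrightarrow> m * t \<le> of_int (min \<lfloor>m * f x\<rfloor> (int j))"
        using m by (simp add: h_def field_simps)
      also have "\<dots> \<longleftrightarrow> \<lceil>m * t\<rceil> \<le> int j \<and> \<lceil>m * t\<rceil> \<le> \<lfloor>m * f x\<rfloor>"
        by (simp add: ceiling_le_iff[symmetric] conj_commute del: of_int_min)
      also have "\<lceil>m * t\<rceil> \<le> \<lfloor>m * f x\<rfloor> \<longleftrightarrow> of_int \<lceil>m * t\<rceil> / m \<le> f x"
        using m by (simp add: le_floor_iff field_simps)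
      finally show ?thesis .
    qed
    then have "super_level (h j) t =
        (if \<lceil>m * t\<rceil> \<le> int j then super_level f (of_int \<lceil>m * t\<rceil> / m) else {})"
      by (auto simp: super_level_def)
    moreover have "of_int \<lceil>m * t\<rceil> / m > 0" using m t by simp
    ultimately show "compact (super_level (h j) t) \<and> convex (super_level (h j) t)"
      using quasi_concave_level[OF f] by simp
  qed
  have "\<mu> (h j) = (LINT x|lborel. profile (h j x))"
  proof (induction j)
    case 0
    have "h 0 = (\<lambda>x. 0)" using f0 m by (auto simp: h_def fun_eq_iff)
    then show ?case by (simp add: profile_0)
  next
    case (Suc j)
    define L where "L = super_level f (Suc j / m)"
    have L: "compact_convex L" unfolding L_def using quasi_concave_level[OF f] m by simp
    let ?s = "Suc j / m" and ?r = "j / m"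
    have r: "0 \<le> ?r" "0 \<le> ?s" using m by auto
    have cases: "(x \<in> L \<and> h (Suc j) x = ?s \<and> h j x = ?r) \<or> (x \<notin> L \<and> h (Suc j) x = h j x \<and> 0 \<le> h j x)" for x
    proof (cases "x \<in> L")
      case True
      then have "real (Suc j) \<le> m * f x" using m by (simp add: L_def super_level_def field_simps)
      then have "int (Suc j) \<le> \<lfloor>m * f x\<rfloor>" by (simp add: le_floor_iff)
      then show ?thesis using True by (simp add: h_def min_def)
    next
      case False
      then have "m * f x < real (Suc j)" using m by (simp add: L_def super_level_def field_simps)
      then have "\<lfloor>m * f x\<rfloor> < int (Suc j)" by (simp add: floor_less_iff)
      then show ?thesis using False qc[of j] quasi_concave_nonneg[of "h j" x] by (simp add: h_def min_def)
    qed
    have max: "(\<lambda>x. max (h j x) (level_fun ?s L x)) = h (Suc j)"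
    proof
      fix x
      have "?r \<le> ?s" using m by (simp add: divide_right_mono)
      then show "max (h j x) (level_fun ?s L x) = h (Suc j) x" using cases[of x] by auto
    qed
    have min: "(\<lambda>x. min (h j x) (level_fun ?s L x)) = level_fun ?r L"
    proof
      fix x
      have "?r \<le> ?s" using m by (simp add: divide_right_mono)
      then show "min (h j x) (level_fun ?s L x) = level_fun ?r L x" using cases[of x] by auto
    qed
    have "\<mu> (h (Suc j)) + \<mu> (level_fun ?r L) = \<mu> (h j) + \<mu> (level_fun ?s L)"
      using max_min[OF qc[of j] level_fun_quasi_concave[OF r(2) L]] qc[of "Suc j"]
      unfolding max min by blast
    moreover have "(LINT x|lborel. profile (h (Suc j) x)) + (LINT x|lborel. profile (level_fun ?r L x)) =
        (LINT x|lborel. profile (h j x)) + (LINT x|lborel. profile (level_fun ?s L x))"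
    proof -
      \<comment> \<open>At each point, maximum and minimum are the two original values, possibly
        swapped.\<close>
      have "profile (h (Suc j) x) + profile (level_fun ?r L x) = profile (h j x) + profile (level_fun ?s L x)" for x
        using cases[of x] by auto
      then have "(LINT x|lborel. profile (h (Suc j) x) + profile (level_fun ?r L x)) =
          (LINT x|lborel. profile (h j x) + profile (level_fun ?s L x))" by simp
      then show ?thesis
        using integrable_profile_comp[OF qc[of j]] integrable_profile_comp[OF qc[of "Suc j"]]
          integrable_profile_comp[OF level_fun_quasi_concave[OF r(1) L]]
          integrable_profile_comp[OF level_fun_quasi_concave[OF r(2) L]]
        by (simp add: Bochner_Integration.integral_add)
    qed
    ultimately show ?case
      using Suc level_fun_eq_profile[OF r(1) L] level_fun_eq_profile[OF r(2) L]
        integral_profile_level_fun[OF r(1) L] integral_profile_level_fun[OF r(2) L] by simp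
  qed
  with qc show ?thesis by blast
qed

text \<open>Rounding \<open>f\<close> down to multiples of \<open>1 / 2 ^ n\<close> gives finitely
  many values and an increasing sequence with limit \<open>f\<close>. Monotone continuity handles
  \<open>\<mu>\<close>, dominated convergence the integral.\<close>

lemma eq_integral_profile:
  fixes f :: "real ^ 'n \<Rightarrow> real"
  assumes f: "f \<in> quasi_concave"
  shows "\<mu> f = (LINT x|lborel. profile (f x))"
proof -
  have f0: "0 \<le> f x" for x using f by (rule quasi_concave_nonneg)
  obtain B where B: "\<And>x. f x < B" using quasi_concave_bounded[OF f] by blast
  define F where "F n x = real_of_int \<lfloor>2 ^ n * f x\<rfloor> / 2 ^ n" for n :: nat and x
  have F_le: "F n x \<le> f x" for n x
    using of_int_floor_le[of "2 ^ n * f x"] by (simp add: F_def field_simps)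
  have F_nonneg: "0 \<le> F n x" for n x using f0 by (simp add: F_def)
  have F: "F n \<in> quasi_concave \<and> \<mu> (F n) = (LINT x|lborel. profile (F n x))" for n
  proof -
    \<comment> \<open>Since \<open>f\<close> is bounded, a cap this high is never reached.\<close>
    obtain j where "2 ^ n * B < real j" using reals_Archimedean2 by blast
    then have "2 ^ n * f x < real j" for x
      using B[of x] by (meson less_trans mult_strict_left_mono zero_less_numeral zero_less_power)
    then have "min \<lfloor>2 ^ n * f x\<rfloor> (int j) = \<lfloor>2 ^ n * f x\<rfloor>" for x
      using le_floor_iff floor_less_iff by (intro min_absorb1 less_imp_le) (simp add: floor_less_iff)
    then show ?thesis
      using truncated_floor_eq_integral[OF f, of "2 ^ n" j] unfolding F_def by simp
  qed
  have F_lim: "(\<lambda>n. F n x) \<longlonglongrightarrow> f x" for x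
  proof (rule tendsto_sandwich)
    show "eventually (\<lambda>n. f x - (1/2)^n \<le> F n x) sequentially"
    proof (rule always_eventually, rule allI)
      fix n
      have "f x - (1/2)^n = (2 ^ n * f x - 1) / 2 ^ n" by (simp add: field_simps power_divide)
      also have "\<dots> \<le> F n x" unfolding F_def by (intro divide_right_mono zero_le_power) linarith+
      finally show "f x - (1/2)^n \<le> F n x" .
    qed
    have "(\<lambda>n. f x - (1/2)^n) \<longlonglongrightarrow> f x - 0" by (intro tendsto_intros) auto
    then show "(\<lambda>n. f x - (1/2)^n) \<longlonglongrightarrow> f x" by simp
  qed (auto simp: F_le)
  have F_inc: "incseq (\<lambda>n. F n x)" for x
  proof (rule incseq_SucI)
    fix n
    \<comment> \<open>Powers of two make each grid of values a refinement of the previous one, which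
      is what gives monotonicity.\<close>
    have "2 * \<lfloor>2 ^ n * f x\<rfloor> \<le> \<lfloor>2 ^ Suc n * f x\<rfloor>"
      using of_int_floor_le[of "2 ^ n * f x"] by (simp add: le_floor_iff)
    then have "of_int (2 * \<lfloor>2 ^ n * f x\<rfloor>) \<le> (of_int \<lfloor>2 ^ Suc n * f x\<rfloor> :: real)" by (rule of_int_le_iff[THEN iffD2])
    then show "F n x \<le> F (Suc n) x" by (simp add: F_def field_simps)
  qed
  obtain \<delta> where \<delta>: "\<delta> > 0" "\<And>t. t \<in> {0..\<delta>} \<Longrightarrow> profile t = 0" using profile_vanishes_near_0 by blast
  obtain C where C: "\<And>t. t \<in> {0..B} \<Longrightarrow> \<bar>profile t\<bar> \<le> C" using profile_bound by blast
  have "(\<lambda>n. LINT x|lborel. profile (F n x)) \<longlonglongrightarrow> (LINT x|lborel. profile (f x))"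
  proof (rule integral_dominated_convergence)
    show "integrable lborel (\<lambda>x. C * indicator (super_level f \<delta>) x)"
      using super_level_borel[OF f] emeasure_super_level_finite[OF f \<delta>(1)] by simp
    show "(\<lambda>x. profile (f x)) \<in> borel_measurable lborel"
      using integrable_profile_comp[OF f] by (rule borel_measurable_integrable)
    show "(\<lambda>x. profile (F n x)) \<in> borel_measurable lborel" for n
      using integrable_profile_comp[of "F n"] F[of n] by (intro borel_measurable_integrable) simp
    show "AE x in lborel. (\<lambda>n. profile (F n x)) \<longlonglongrightarrow> profile (f x)"
      using F_lim f0 F_nonneg
      by (intro AE_I2 continuous_on_tendsto_compose[OF continuous_on_profile]) auto
    show "AE x in lborel. norm (profile (F n x)) \<le> C * indicator (super_level f \<delta>) x" for n
    proof (rule AE_I2)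
      fix x
      show "norm (profile (F n x)) \<le> C * indicator (super_level f \<delta>) x"
      proof (cases "x \<in> super_level f \<delta>")
        case True
        have "F n x \<le> B" using F_le[of n x] B[of x] by simp
        then have "\<bar>profile (F n x)\<bar> \<le> C" using F_nonneg[of n x] by (intro C) simp
        then show ?thesis using True by simp
      next
        \<comment> \<open>Rounding down keeps the values below \<open>\<delta>\<close> here, so one
          level of \<open>f\<close> supports all the integrands.\<close>
        case False
        then have "F n x \<le> \<delta>" using F_le[of n x] by (simp add: super_level_def)
        then have "profile (F n x) = 0" using F_nonneg[of n x] by (intro \<delta>(2)) simp
        then show ?thesis using False by simp
      qed
    qed
  qed
  moreover have "(\<lambda>n. \<mu> (F n)) \<longlonglongrightarrow> \<mu> f"
    using f F F_lim F_inc by (intro continuous_incseq) auto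
  ultimately show ?thesis using F LIMSEQ_unique by simp
qed

end

section \<open>Existence and uniqueness of the density\<close>

lemma borel_measurable_restrict_Ioi:
  fixes c :: "real \<Rightarrow> real"
  assumes "continuous_on {0..} c"
  shows "c \<in> borel_measurable (restrict_space borel {0<..})"
  by (rule borel_measurable_continuous_on_restrict) (use assms in \<open>auto elim: continuous_on_subset\<close>)

lemma integral_S_N:
  fixes f :: "real ^ 'n \<Rightarrow> real" and c :: "real \<Rightarrow> real"
  assumes "f \<in> quasi_concave" "continuous_on {0..} c" "c 0 = 0"
  shows "(LINT t|S_N f. c t) = (LINT x|lborel. c (f x))"
  using integral_level_measure[OF assms(1) borel_measurable_restrict_Ioi[OF assms(2)] assms(3)]
  by (simp add: S_N_eq_level_measure[OF assms(1)])

theorem theorem1p2: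
  fixes \<mu> :: "(real ^ 'n \<Rightarrow> real) \<Rightarrow> real"
  assumes "continuous_valuation \<mu>"
    and "translation_invariant \<mu>"
    and "homogeneous CARD('n) \<mu>"
  shows "\<exists>!c. c \<in> extensional {0..} \<and>
           continuous_on {0..} c \<and>
           (\<exists>\<delta>>0. \<forall>t\<in>{0..\<delta>}. c t = 0) \<and>
           (\<forall>f\<in>quasi_concave. \<mu> f = (LINT t|S_N f. c t))"
proof -
  interpret volume_degree_valuation \<mu> by unfold_locales fact+
  show ?thesis
  proof (rule ex1I)
    \<comment> \<open>A function on the half-line is represented by an extensional one, with a fixed
      default at negative arguments, so that uniqueness is equality of total functions.\<close>
    let ?c = "restrict profile {0..}"
    have cont: "continuous_on {0..} ?c"
      using continuous_on_profile by (rule continuous_on_eq) simp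
    moreover have "\<exists>\<delta>>0. \<forall>t\<in>{0..\<delta>}. ?c t = 0" using profile_vanishes_near_0 by auto
    moreover have "\<mu> f = (LINT t|S_N f. ?c t)" if f: "f \<in> quasi_concave" for f
      using integral_S_N[OF f cont] eq_integral_profile[OF f] quasi_concave_nonneg[OF f] profile_0 by simp
    ultimately show "?c \<in> extensional {0..} \<and> continuous_on {0..} ?c \<and>
        (\<exists>\<delta>>0. \<forall>t\<in>{0..\<delta>}. ?c t = 0) \<and> (\<forall>f\<in>quasi_concave. \<mu> f = (LINT t|S_N f. ?c t))"
      by simp
  next
    fix c assume c: "c \<in> extensional {0..} \<and> continuous_on {0..} c \<and>
        (\<exists>\<delta>>0. \<forall>t\<in>{0..\<delta>}. c t = 0) \<and> (\<forall>f\<in>quasi_concave. \<mu> f = (LINT t|S_N f. c t))"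
    then have c0: "c 0 = 0" by force
    show "c = restrict profile {0..}"
    proof (rule extensionalityI)
      fix t :: real assume t: "t \<in> {0..}"
      \<comment> \<open>Testing the representation on \<open>t\<close> times the indicator of the
        unit cube recovers \<open>c t\<close>, because the cube has volume 1 and
        \<open>c 0 = 0\<close>.\<close>
      let ?f = "level_fun t (cbox 0 (One :: real ^ 'n))"
      have f: "?f \<in> quasi_concave" using t by (intro level_fun_quasi_concave unit_cube) simp
      have "profile t = (LINT t|S_N ?f. c t)" using c f by (simp add: profile_def)
      also have "\<dots> = (LINT x|lborel. c (?f x))" using c c0 by (intro integral_S_N f) auto
      also have "\<dots> = (LINT x|lborel. c t * indicator (cbox 0 (One :: real ^ 'n)) x)"
        using c0 by (intro Bochner_Integration.integral_cong) (auto simp: indicator_def)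
      also have "\<dots> = c t" by simp
      finally show "c t = restrict profile {0..} t" using t by simp
    qed (use c in auto)
  qed
qed

end
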